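(* Suppose that every subset $S\subseteq\Delta_2(\mathcal E_1)$ which is a set of Bohr recurrence in $\mathbb Z^\omega$ is a set of chromatic recurrence in $\mathbb Z^\omega$. Then for every countably infinite abelian group $G$, every $S\subseteq G$ which is a set of Bohr recurrence in $G$ is a set of chromatic recurrence in $G$.
   Context: All groups are discrete. $\mathbb Z^\omega$ is the direct sum of countably many copies of $\mathbb Z$ (sequences $(n_1,n_2,\dots)$ of integers with all but finitely many $n_j$ equal to $0$). For $j\in\mathbb N$, $\mathbf e_j\in\mathbb Z^\omega$ is the element with $j$-th coordinate $1$ and all other coordinates $0$, and $\mathcal E_1:=\{\mathbf e_j:j\in\mathbb N\}$. For a subset $A$ of an abelian group, $\Delta_2(A):=\{(a-b)-(c-d):a,b,c,d\in A\text{ mutually distinct}\}$. $\mathbb T=\mathbb R/\mathbb Z$; for $\mathbf x=(x_1,\dots,x_d)\in\mathbb T^d$, $\|\mathbf x\|:=\max_{j\le d}\min_{n\in\mathbb Z}|x_j-n|$. For an abelian group $G$: $S\subseteq G$ is a set of Bohr recurrence if for every $d\in\mathbb N$, every homomorphism $\rho:G\to\mathbb T^d$, and every $\varepsilon>0$, there exists $s\in S$ with $\|\rho(s)\|<\varepsilon$. $S\subseteq G$ is a set of chromatic recurrence if for every $r\in\mathbb N$ and every $f:G\to\{1,\dots,r\}$ there exist $a,b\in G$ such that $f(a)=f(b)$ and $b-a\in S$. *)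

theory Defs
  imports Complex_Main "HOL-Algebra.Free_Abelian_Groups" "HOL-Library.Countable_Set"
begin

definition real_group :: "real monoid" where
  "real_group = \<lparr>carrier = UNIV, monoid.mult = (+), one = 0\<rparr>"

definition circle_group :: "real set monoid" where
  "circle_group = real_group Mod \<int>"

definition torus_group :: "nat \<Rightarrow> (nat \<Rightarrow> real set) monoid" where
  "torus_group d = product_group {1..d} (\<lambda>_. circle_group)"

text \<open>An element of the circle group is a coset \<open>x + \<int> = {x - n | n. n \<in> \<int>}\<close>, so the distance
  from \<open>x\<close> to the nearest integer is the least absolute value of an element of the coset
  (it is attained, see \<open>circle_norm_coset\<close> below).\<close>

definition circle_norm :: "real set \<Rightarrow> real" where
  "circle_norm X = (INF t\<in>X. \<bar>t\<bar>)"

text \<open>Only meaningful for \<open>d \<ge> 1\<close>.\<close>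

definition torus_norm :: "nat \<Rightarrow> (nat \<Rightarrow> real set) \<Rightarrow> real" where
  "torus_norm d x = Max ((\<lambda>j. circle_norm (x j)) ` {1..d})"

text \<open>Abelian groups are written multiplicatively: \<open>a - b\<close> is \<open>a \<otimes>\<^bsub>G\<^esub> inv\<^bsub>G\<^esub> b\<close>.\<close>

definition Bohr_recurrence :: "('a, 'b) monoid_scheme \<Rightarrow> 'a set \<Rightarrow> bool" where
  "Bohr_recurrence G S \<longleftrightarrow>
     (\<forall>d\<ge>1. \<forall>\<rho>\<in>hom G (torus_group d). \<forall>\<epsilon>>0. \<exists>s\<in>S. torus_norm d (\<rho> s) < \<epsilon>)"

definition chromatic_recurrence :: "('a, 'b) monoid_scheme \<Rightarrow> 'a set \<Rightarrow> bool" where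
  "chromatic_recurrence G S \<longleftrightarrow>
     (\<forall>r\<ge>1. \<forall>f\<in>carrier G \<rightarrow> {1..r::nat}.
        \<exists>a\<in>carrier G. \<exists>b\<in>carrier G. f a = f b \<and> b \<otimes>\<^bsub>G\<^esub> inv\<^bsub>G\<^esub> a \<in> S)"

definition Delta2 :: "('a, 'b) monoid_scheme \<Rightarrow> 'a set \<Rightarrow> 'a set" where
  "Delta2 G A = {(a \<otimes>\<^bsub>G\<^esub> inv\<^bsub>G\<^esub> b) \<otimes>\<^bsub>G\<^esub> inv\<^bsub>G\<^esub> (c \<otimes>\<^bsub>G\<^esub> inv\<^bsub>G\<^esub> d) | a b c d.
     a \<in> A \<and> b \<in> A \<and> c \<in> A \<and> d \<in> A \<and> distinct [a, b, c, d]}"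

text \<open>The group \<open>\<int>\<^sup>\<omega>\<close> of finitely supported integer sequences under pointwise addition;
  coordinates are indexed from 0.\<close>

definition Z_omega :: "(nat \<Rightarrow>\<^sub>0 int) monoid" where
  "Z_omega = free_Abelian_group (UNIV :: nat set)"

definition E1 :: "(nat \<Rightarrow>\<^sub>0 int) set" where
  "E1 = {Poly_Mapping.single j 1 | j. True}"

lemma comm_group_real_group: "comm_group real_group"
proof (rule comm_groupI)
  fix x :: real
  show "\<exists>y\<in>carrier real_group. y \<otimes>\<^bsub>real_group\<^esub> x = \<one>\<^bsub>real_group\<^esub>"
    by (rule bexI[of _ "- x"]) (auto simp: real_group_def)
qed (auto simp: real_group_def)

lemma subgroup_Ints_real_group: "subgroup \<int> real_group"
proof -
  interpret comm_group real_group by (rule comm_group_real_group)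
  have inv: "inv\<^bsub>real_group\<^esub> x = - x" for x
    by (rule inv_equality) (auto simp: real_group_def)
  show ?thesis
    by (rule subgroupI) (auto simp: inv, auto simp: real_group_def)
qed

lemma comm_group_circle_group: "comm_group circle_group"
  unfolding circle_group_def
  by (rule comm_group.abelian_FactGroup[OF comm_group_real_group subgroup_Ints_real_group])

lemma carrier_circle_group: "carrier circle_group = {{x - of_int n | n::int. True} | x. True}"
proof -
  have "\<int> #>\<^bsub>real_group\<^esub> x = {x - of_int n | n::int. True}" for x
  proof -
    have "\<exists>n::int. of_int m + x = x - of_int n" for m :: int
      by (rule exI[of _ "- m"]) simp
    moreover have "\<exists>t\<in>\<int>. x - of_int n = t + x" for n :: int
      by (rule bexI[of _ "of_int (- n)"]) (simp, rule Ints_of_int)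
    ultimately show ?thesis
      by (auto simp: r_coset_def real_group_def elim!: Ints_cases)
  qed
  then show ?thesis
    by (auto simp: circle_group_def carrier_FactGroup real_group_def)
qed

lemma circle_norm_coset:
  fixes x :: real
  defines "X \<equiv> {x - of_int n | n::int. True}"
  shows "circle_norm X = \<bar>x - of_int (round x)\<bar>" "\<bar>x - of_int n\<bar> \<ge> circle_norm X"
proof -
  have le: "\<bar>x - of_int (round x)\<bar> \<le> \<bar>x - of_int n\<bar>" for n
    using round_diff_minimal[of x n] .
  show eq: "circle_norm X = \<bar>x - of_int (round x)\<bar>"
    unfolding circle_norm_def by (rule cInf_eq_minimum) (use le in \<open>auto simp: X_def\<close>)
  show "\<bar>x - of_int n\<bar> \<ge> circle_norm X"
    using le by (simp add: eq)
qed

end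

theory Submission
  imports Defs "HOL-Analysis.Topology_Euclidean_Space" "HOL-Analysis.Function_Topology"
    "HOL-Library.Function_Algebras"
begin

text \<open>Map \<open>\<int>\<^sup>\<omega>\<close> to \<open>G\<close> so that every element of \<open>G\<close> is the image of infinitely many generators
  \<open>e\<^sub>j\<close>; chromatic recurrence passes to images, so the point is that the preimage of a set \<open>S\<close> of Bohr
  recurrence, intersected with \<open>\<Delta>\<^sub>2(E\<^sub>1)\<close>, is a set of Bohr recurrence. A homomorphism from \<open>\<int>\<^sup>\<omega>\<close> to
  a torus, partitioned into small cells, colours \<open>G\<close>: give \<open>x\<close> a cell visited by infinitely many
  \<open>e\<^sub>j\<close> above \<open>x\<close>. It then suffices that \<open>S\<close> meets the set of all \<open>(w - x) - (y - z)\<close>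
  with \<open>w, x, y, z\<close> of one colour, which holds because this set contains a Bohr neighbourhood of
  the identity (Bogolyubov's theorem for colourings of a countable abelian group).

  For Bogolyubov's theorem, pull the colouring back to \<open>\<int>\<^sup>n\<close> along the first \<open>n\<close> elements of \<open>G\<close> and let
  \<open>A\<close> be a large colour class in a huge box. Finite Fourier analysis writes the correlations
  \<open>\<phi>(g) = |A \<inter> (A - g)|\<close> as \<open>\<Sum> \<mu>(\<xi>) \<xi>(g)\<close> with \<open>\<mu> \<ge> 0\<close>. Averaging \<open>\<phi>(h) \<phi>(g - h)\<close> over differences \<open>h\<close>
  of points of a smaller box gives
  \<open>\<Sum> \<mu>(\<eta>) M(\<eta>) \<eta>(g)\<close>, where \<open>M(\<eta>) \<ge> 0\<close> measures the mass of \<open>\<mu>\<close> close to \<open>\<eta>\<close>. Characters with small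
  \<open>M\<close> are negligible, and the others cluster around a number of characters bounded
  independently of \<open>n\<close>. As \<open>A\<close> is almost invariant under the relations of \<open>G\<close>, almost all
  characters are almost trivial on these, so a compactness argument produces characters of \<open>G\<close>.\<close>

section \<open>Positive combinations of characters\<close>

lemma char_diff:
  fixes \<psi> :: "'v::ab_group_add \<Rightarrow> complex"
  assumes "\<And>g. cmod (\<psi> g) = 1" and "\<And>g h. \<psi> (g + h) = \<psi> g * \<psi> h"
  shows "\<psi> (g - h) = \<psi> g * cnj (\<psi> h)"
proof -
  have "\<psi> g = \<psi> (g - h) * \<psi> h"
    using assms(2)[of "g - h" h] by simp
  moreover have "\<psi> h * cnj (\<psi> h) = 1"
    by (simp add: complex_norm_square[symmetric] assms(1))
  ultimately show ?thesis
    by (simp add: mult.assoc)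
qed

text \<open>Vitali-style selection: take \<open>\<Theta>\<close> maximal in \<open>Y\<close> with
  the sets \<open>U \<theta>\<close> pairwise disjoint. Each consumes mass at least
  \<open>\<sigma>\<close> out of a total of at most 1, which bounds the cardinality, and maximality
  makes every \<open>U \<eta>\<close> meet a chosen one.\<close>

lemma maximal_disjoint_subfamily:
  fixes \<mu> :: "'x \<Rightarrow> real" and U :: "'y \<Rightarrow> 'x set"
  assumes "finite X" "finite Y" "\<And>\<xi>. \<xi> \<in> X \<Longrightarrow> 0 \<le> \<mu> \<xi>" "sum \<mu> X \<le> 1"
    and U: "\<And>\<eta>. \<eta> \<in> Y \<Longrightarrow> U \<eta> \<subseteq> X" "\<And>\<eta>. \<eta> \<in> Y \<Longrightarrow> \<sigma> \<le> sum \<mu> (U \<eta>)" and "\<sigma> > 0"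
  obtains \<Theta> where "\<Theta> \<subseteq> Y" "real (card \<Theta>) \<le> 1 / \<sigma>" "\<And>\<eta>. \<eta> \<in> Y \<Longrightarrow> \<exists>\<theta>\<in>\<Theta>. U \<eta> \<inter> U \<theta> \<noteq> {}"
proof -
  let ?F = "{\<Theta>. \<Theta> \<subseteq> Y \<and> disjoint_family_on U \<Theta>}"
  have "finite ?F" "?F \<noteq> {}"
    using \<open>finite Y\<close> by (auto intro: exI[of _ "{}"] simp: disjoint_family_on_def)
  then obtain \<Theta> where \<Theta>: "\<Theta> \<in> ?F" and max: "\<And>\<Theta>'. \<Theta>' \<in> ?F \<Longrightarrow> \<Theta> \<subseteq> \<Theta>' \<Longrightarrow> \<Theta> = \<Theta>'"
    using finite_has_maximal[of ?F] by metis
  have fin: "finite \<Theta>"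
    using \<Theta> \<open>finite Y\<close> finite_subset by auto
  have Usub: "U \<theta> \<subseteq> X" if "\<theta> \<in> \<Theta>" for \<theta>
    using U(1) \<Theta> that by auto
  have "real (card \<Theta>) * \<sigma> \<le> (\<Sum>\<theta>\<in>\<Theta>. sum \<mu> (U \<theta>))"
    using sum_mono[of \<Theta> "\<lambda>_. \<sigma>" "\<lambda>\<theta>. sum \<mu> (U \<theta>)"] U(2) \<Theta> by auto
  also have "\<dots> = sum \<mu> (\<Union>\<theta>\<in>\<Theta>. U \<theta>)"
    using \<Theta> fin Usub \<open>finite X\<close>
    by (intro sum.UNION_disjoint[symmetric]) (auto simp: disjoint_family_on_def intro: finite_subset)
  also have "\<dots> \<le> sum \<mu> X"
    using Usub assms(1,3) by (intro sum_mono2) auto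
  finally have "real (card \<Theta>) \<le> 1 / \<sigma>"
    using assms(4) \<open>\<sigma> > 0\<close> by (simp add: pos_le_divide_eq)
  moreover have "\<exists>\<theta>\<in>\<Theta>. U \<eta> \<inter> U \<theta> \<noteq> {}" if "\<eta> \<in> Y" for \<eta>
  proof (rule ccontr)
    assume neg: "\<not> ?thesis"
    then have "insert \<eta> \<Theta> \<in> ?F"
      using \<Theta> that by (auto simp: disjoint_family_on_def)
    then have "\<eta> \<in> \<Theta>"
      using max[of "insert \<eta> \<Theta>"] by blast
    \<comment> \<open>Now \<open>\<eta>\<close> is itself a candidate for \<open>\<theta>\<close> in
      \<open>neg\<close>, so \<open>U \<eta>\<close> is disjoint from itself.\<close>
    with neg have "U \<eta> = {}" by auto
    then show False
      using U(2)[OF that] \<open>\<sigma> > 0\<close> by simp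
  qed
  ultimately show thesis
    using that \<Theta> by blast
qed

text \<open>For characters, \<open>ch \<xi> (a - b) * ch \<eta> (t - (a - b))\<close> equals
  \<open>ch \<eta> t * z a * cnj (z b)\<close> with
  \<open>z a = ch \<xi> a * cnj (ch \<eta> a)\<close>. Summing over \<open>a\<close> and
  \<open>b\<close> turns the last two factors into a squared modulus, so nonnegative
  \<open>\<mu>\<close> give nonnegative coefficients.\<close>

lemma convolution_square_expansion:
  fixes ch :: "'x \<Rightarrow> 'v::ab_group_add \<Rightarrow> complex" and \<mu> :: "'x \<Rightarrow> real"
  assumes ch: "\<And>\<xi> g. \<xi> \<in> X \<Longrightarrow> cmod (ch \<xi> g) = 1"
      "\<And>\<xi> g h. \<xi> \<in> X \<Longrightarrow> ch \<xi> (g + h) = ch \<xi> g * ch \<xi> h"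
  defines "\<phi> \<equiv> \<lambda>g. \<Sum>\<xi>\<in>X. of_real (\<mu> \<xi>) * ch \<xi> g"
  shows "(\<Sum>a\<in>H. \<Sum>b\<in>H. \<phi> (a - b) * \<phi> (t - (a - b))) =
    (\<Sum>\<eta>\<in>X. of_real (\<mu> \<eta> * (\<Sum>\<xi>\<in>X. \<mu> \<xi> * (cmod (\<Sum>a\<in>H. ch \<xi> a * cnj (ch \<eta> a)))\<^sup>2)) * ch \<eta> t)"
proof -
  have diff: "ch \<xi> (g - h) = ch \<xi> g * cnj (ch \<xi> h)" if "\<xi> \<in> X" for \<xi> g h
    by (rule char_diff) (use ch that in auto)
  have norm_sq: "of_real ((cmod (\<Sum>a\<in>H. ch \<xi> a * cnj (ch \<eta> a)))\<^sup>2) =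
      (\<Sum>a\<in>H. \<Sum>b\<in>H. (ch \<xi> a * cnj (ch \<eta> a)) * cnj (ch \<xi> b * cnj (ch \<eta> b)))" for \<xi> \<eta>
    by (simp only: complex_norm_square cnj_sum sum_product)
  define F where "F a b \<xi> \<eta> = of_real (\<mu> \<xi> * \<mu> \<eta>) * ch \<eta> t *
      ((ch \<xi> a * cnj (ch \<eta> a)) * cnj (ch \<xi> b * cnj (ch \<eta> b)))" for a b \<xi> \<eta>
  have "(\<Sum>a\<in>H. \<Sum>b\<in>H. \<phi> (a - b) * \<phi> (t - (a - b))) =
     (\<Sum>a\<in>H. \<Sum>b\<in>H. \<Sum>\<xi>\<in>X. \<Sum>\<eta>\<in>X. F a b \<xi> \<eta>)"
    unfolding \<phi>_def sum_product by (intro sum.cong refl) (simp add: F_def diff ch(2) algebra_simps)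
  also have "\<dots> = (\<Sum>a\<in>H. \<Sum>\<xi>\<in>X. \<Sum>\<eta>\<in>X. \<Sum>b\<in>H. F a b \<xi> \<eta>)"
    by (rule sum.cong[OF refl], subst sum.swap, rule sum.cong[OF refl], rule sum.swap)
  also have "\<dots> = (\<Sum>\<eta>\<in>X. \<Sum>\<xi>\<in>X. \<Sum>a\<in>H. \<Sum>b\<in>H. F a b \<xi> \<eta>)"
    by (rule trans[OF sum.swap trans[OF sum.cong[OF refl sum.swap] sum.swap]])
  also have "\<dots> = (\<Sum>\<eta>\<in>X. \<Sum>\<xi>\<in>X. of_real (\<mu> \<xi> * \<mu> \<eta>) * ch \<eta> t *
        of_real ((cmod (\<Sum>a\<in>H. ch \<xi> a * cnj (ch \<eta> a)))\<^sup>2))"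
    by (simp only: F_def sum_distrib_left norm_sq)
  finally show ?thesis
    by (simp add: sum_distrib_left sum_distrib_right mult_ac)
qed

text \<open>If \<open>\<phi>(a - b) \<phi>(t - (a - b))\<close> vanished for all \<open>a, b \<in> H\<close>, then so would the sum of
  \<open>\<mu>(\<eta>) M(\<eta>) Re (\<eta>(t))\<close>. Of its total weight, at least \<open>7\<tau>\<close>, all but \<open>2\<tau>\<close> sits on characters with
  \<open>M(\<eta>) \<ge> \<tau>\<close>, for which \<open>Re (\<eta>(t)) \<ge> 1/2\<close>.\<close>

lemma few_characters_suffice:
  fixes ch :: "'x \<Rightarrow> 'v::ab_group_add \<Rightarrow> complex" and \<mu> :: "'x \<Rightarrow> real"
  assumes X: "finite X" "X' \<subseteq> X" "\<xi>\<^sub>0 \<in> X"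
    and ch: "\<And>\<xi> g. \<xi> \<in> X \<Longrightarrow> cmod (ch \<xi> g) = 1"
      "\<And>\<xi> g h. \<xi> \<in> X \<Longrightarrow> ch \<xi> (g + h) = ch \<xi> g * ch \<xi> h"
    and \<mu>: "\<And>\<xi>. \<xi> \<in> X \<Longrightarrow> 0 \<le> \<mu> \<xi>" "sum \<mu> X \<le> 1" "(\<mu> \<xi>\<^sub>0)\<^sup>2 \<ge> 7 * \<tau>" "sum \<mu> (X - X') \<le> \<tau>"
    and \<tau>: "\<tau> > 0" and H: "finite H" "H \<noteq> {}"
    and close: "\<And>\<xi> \<eta> t. \<xi> \<in> X \<Longrightarrow> \<eta> \<in> X \<Longrightarrow> t \<in> T \<Longrightarrow>
      (cmod ((\<Sum>a\<in>H. ch \<xi> a * cnj (ch \<eta> a)) / of_nat (card H)))\<^sup>2 \<ge> \<tau> / 2 \<Longrightarrow> cmod (ch \<xi> t - ch \<eta> t) \<le> 1/8"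
  defines "\<phi> \<equiv> \<lambda>g. \<Sum>\<xi>\<in>X. of_real (\<mu> \<xi>) * ch \<xi> g"
  obtains \<Theta> where "\<Theta> \<subseteq> X'" "real (card \<Theta>) \<le> 2 / \<tau>"
    "\<And>t. t \<in> T \<Longrightarrow> (\<And>\<theta>. \<theta> \<in> \<Theta> \<Longrightarrow> cmod (ch \<theta> t - 1) \<le> 1/4) \<Longrightarrow>
      \<exists>a\<in>H. \<exists>b\<in>H. \<phi> (a - b) \<noteq> 0 \<and> \<phi> (t - (a - b)) \<noteq> 0"
proof -
  \<comment> \<open>Squared normalised inner product of two characters over \<open>H\<close>. By
    \<open>close\<close>, a value of at least \<open>\<tau> / 2\<close> forces them to differ by at
    most 1/8 on \<open>T\<close>.\<close>
  define K where "K \<xi> \<eta> = (cmod ((\<Sum>a\<in>H. ch \<xi> a * cnj (ch \<eta> a)) / of_nat (card H)))\<^sup>2" for \<xi> \<eta>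
  define M where "M \<eta> = (\<Sum>\<xi>\<in>X. \<mu> \<xi> * K \<xi> \<eta>)" for \<eta>
  have cH: "card H > 0"
    using H by (simp add: card_gt_0_iff)
  have K0: "0 \<le> K \<xi> \<eta>" for \<xi> \<eta>
    by (simp add: K_def)
  have K1: "K \<xi> \<eta> \<le> 1" if "\<xi> \<in> X" "\<eta> \<in> X" for \<xi> \<eta>
  proof -
    have "cmod (\<Sum>a\<in>H. ch \<xi> a * cnj (ch \<eta> a)) \<le> real (card H)"
      using sum_norm_le[of H "\<lambda>a. ch \<xi> a * cnj (ch \<eta> a)" "\<lambda>_. 1"] ch that by (simp add: norm_mult)
    then show ?thesis
      using cH by (auto simp: K_def norm_divide intro!: power_le_one)
  qed
  have K_diag: "K \<xi>\<^sub>0 \<xi>\<^sub>0 = 1"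
    using cH X ch(1) by (simp add: K_def complex_norm_square[symmetric])
  have M0: "0 \<le> M \<eta>" for \<eta>
    unfolding M_def using \<mu>(1) K0 by (simp add: sum_nonneg)
  have M1: "M \<eta> \<le> 1" if "\<eta> \<in> X" for \<eta>
  proof -
    have "M \<eta> \<le> sum \<mu> X"
      unfolding M_def using \<mu>(1) K1[OF _ that] by (intro sum_mono) (simp add: mult_left_le)
    then show ?thesis using \<mu>(2) by simp
  qed
  define Y where "Y = {\<eta> \<in> X'. \<tau> \<le> M \<eta>}"
  define U where "U \<eta> = {\<xi> \<in> X. \<tau> / 2 \<le> K \<xi> \<eta>}" for \<eta>
  have finY: "finite Y"
    using finite_subset[OF X(2,1)] by (simp add: Y_def)
  \<comment> \<open>Characters outside \<open>U \<eta>\<close> contribute at most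
    \<open>\<tau> / 2\<close> to \<open>M \<eta> \<ge> \<tau>\<close>, and those inside contribute
    at most their mass.\<close>
  have U_mass: "\<tau> / 2 \<le> sum \<mu> (U \<eta>)" if "\<eta> \<in> Y" for \<eta>
  proof -
    have \<eta>: "\<eta> \<in> X" using that X by (auto simp: Y_def)
    have "M \<eta> = (\<Sum>\<xi>\<in>U \<eta>. \<mu> \<xi> * K \<xi> \<eta>) + (\<Sum>\<xi>\<in>X - U \<eta>. \<mu> \<xi> * K \<xi> \<eta>)"
      unfolding M_def using X by (subst sum.subset_diff[of "U \<eta>"]) (auto simp: U_def)
    also have "\<dots> \<le> sum \<mu> (U \<eta>) + (\<Sum>\<xi>\<in>X - U \<eta>. \<mu> \<xi> * (\<tau> / 2))"
    proof (intro add_mono sum_mono)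
      show "\<mu> \<xi> * K \<xi> \<eta> \<le> \<mu> \<xi>" if "\<xi> \<in> U \<eta>" for \<xi>
        using that \<mu>(1) K1[OF _ \<eta>] by (auto simp: U_def mult_left_le)
      show "\<mu> \<xi> * K \<xi> \<eta> \<le> \<mu> \<xi> * (\<tau> / 2)" if "\<xi> \<in> X - U \<eta>" for \<xi>
        using that \<mu>(1) by (intro mult_left_mono) (auto simp: U_def)
    qed
    also have "(\<Sum>\<xi>\<in>X - U \<eta>. \<mu> \<xi> * (\<tau> / 2)) \<le> 1 * (\<tau> / 2)"
      unfolding sum_distrib_right[symmetric]
      using \<tau> \<mu> X by (intro mult_right_mono order_trans[OF sum_mono2[of X] \<mu>(2)]) auto
    finally show ?thesis
      using that by (simp add: Y_def)
  qed
  obtain \<Theta> where \<Theta>: "\<Theta> \<subseteq> Y" "real (card \<Theta>) \<le> 1 / (\<tau> / 2)"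
    and meet: "\<And>\<eta>. \<eta> \<in> Y \<Longrightarrow> \<exists>\<theta>\<in>\<Theta>. U \<eta> \<inter> U \<theta> \<noteq> {}"
    by (rule maximal_disjoint_subfamily[OF X(1) finY \<mu>(1,2), of U "\<tau> / 2"])
      (use U_mass \<tau> in \<open>auto simp: U_def\<close>)
  have "\<exists>a\<in>H. \<exists>b\<in>H. \<phi> (a - b) \<noteq> 0 \<and> \<phi> (t - (a - b)) \<noteq> 0"
    if t: "t \<in> T" and small: "\<And>\<theta>. \<theta> \<in> \<Theta> \<Longrightarrow> cmod (ch \<theta> t - 1) \<le> 1/4" for t
  proof (rule ccontr)
    assume neg: "\<not> ?thesis"
    \<comment> \<open>Pass from 1 to \<open>ch \<theta> t\<close>, then to
      \<open>ch \<xi> t\<close>, then to \<open>ch \<eta> t\<close>, where \<open>\<xi>\<close> lies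
      in both \<open>U \<theta>\<close> and \<open>U \<eta>\<close>. The errors 1/4, 1/8 and 1/8 add
      up to 1/2.\<close>
    have Re_Y: "1 / 2 \<le> Re (ch \<eta> t)" if \<eta>: "\<eta> \<in> Y" for \<eta>
    proof -
      obtain \<theta> \<xi> where \<theta>: "\<theta> \<in> \<Theta>" "\<xi> \<in> U \<eta>" "\<xi> \<in> U \<theta>"
        using meet[OF \<eta>] by blast
      have "cmod (ch \<xi> t - ch \<eta> t) \<le> 1/8" "cmod (ch \<xi> t - ch \<theta> t) \<le> 1/8"
        by (rule close[folded K_def, OF _ _ t]; use \<theta> \<eta> \<Theta> X in \<open>auto simp: U_def Y_def\<close>)+
      then have "cmod (1 - ch \<eta> t) \<le> 1/2"
        using small[OF \<theta>(1)] norm_triangle_ineq[of "1 - ch \<theta> t" "ch \<theta> t - ch \<eta> t"]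
          norm_triangle_ineq[of "ch \<theta> t - ch \<xi> t" "ch \<xi> t - ch \<eta> t"]
        by (simp add: norm_minus_commute)
      then show ?thesis
        using complex_Re_le_cmod[of "1 - ch \<eta> t"] by simp
    qed
    have Re_X: "- 1 \<le> Re (ch \<eta> t)" if "\<eta> \<in> X" for \<eta>
      using abs_Re_le_cmod[of "ch \<eta> t"] ch(1)[OF that, of t] by linarith
    have YX: "Y \<subseteq> X" using X by (auto simp: Y_def)
    have "(\<Sum>a\<in>H. \<Sum>b\<in>H. \<phi> (a - b) * \<phi> (t - (a - b))) = 0"
      using neg by (intro sum.neutral ballI) auto
    moreover have "(\<Sum>a\<in>H. \<Sum>b\<in>H. \<phi> (a - b) * \<phi> (t - (a - b))) =
        (\<Sum>\<eta>\<in>X. of_real (\<mu> \<eta> * (\<Sum>\<xi>\<in>X. \<mu> \<xi> * (cmod (\<Sum>a\<in>H. ch \<xi> a * cnj (ch \<eta> a)))\<^sup>2)) * ch \<eta> t)"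
      unfolding \<phi>_def by (rule convolution_square_expansion[where X = X and ch = ch and H = H and t = t and \<mu> = \<mu>, OF ch])
    moreover have "(\<Sum>\<xi>\<in>X. \<mu> \<xi> * (cmod (\<Sum>a\<in>H. ch \<xi> a * cnj (ch \<eta> a)))\<^sup>2) = M \<eta> * (real (card H))\<^sup>2" for \<eta>
      unfolding M_def sum_distrib_right
      by (intro sum.cong refl) (use cH in \<open>simp add: K_def norm_divide power_divide\<close>)
    ultimately have "(\<Sum>\<eta>\<in>X. of_real (\<mu> \<eta> * (M \<eta> * (real (card H))\<^sup>2)) * ch \<eta> t) = 0"
      by simp
    then have "Re (\<Sum>\<eta>\<in>X. of_real (\<mu> \<eta> * (M \<eta> * (real (card H))\<^sup>2)) * ch \<eta> t) = 0"
      by (metis zero_complex.sel(1))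
    then have "(\<Sum>\<eta>\<in>X. \<mu> \<eta> * M \<eta> * Re (ch \<eta> t)) * (real (card H))\<^sup>2 = 0"
      unfolding sum_distrib_right by (simp add: mult_ac del: of_real_mult)
    then have "0 = (\<Sum>\<eta>\<in>X. \<mu> \<eta> * M \<eta> * Re (ch \<eta> t))"
      using cH by simp
    also have "\<dots> = (\<Sum>\<eta>\<in>Y. \<mu> \<eta> * M \<eta> * Re (ch \<eta> t)) + (\<Sum>\<eta>\<in>X - Y. \<mu> \<eta> * M \<eta> * Re (ch \<eta> t))"
      by (simp add: sum.subset_diff[OF YX X(1)])
    also have "\<dots> \<ge> (\<Sum>\<eta>\<in>Y. \<mu> \<eta> * M \<eta> * (1/2)) + (\<Sum>\<eta>\<in>X - Y. \<mu> \<eta> * M \<eta> * (-1))"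
      using \<mu>(1) M0 Re_X Re_Y YX by (intro add_mono sum_mono mult_left_mono) auto
    finally have *: "(\<Sum>\<eta>\<in>Y. \<mu> \<eta> * M \<eta>) / 2 \<le> (\<Sum>\<eta>\<in>X - Y. \<mu> \<eta> * M \<eta>)"
      by (simp add: sum_divide_distrib[symmetric] sum_negf)
    \<comment> \<open>Outside \<open>X'\<close> use \<open>M \<eta> \<le> 1\<close> and the small
      mass of \<open>X - X'\<close>; inside \<open>X'\<close> but outside \<open>Y\<close> use
      \<open>M \<eta> \<le> \<tau>\<close>. Each case costs at most \<open>\<tau>\<close> in
      total.\<close>
    have "(\<Sum>\<eta>\<in>X - Y. \<mu> \<eta> * M \<eta>) \<le> (\<Sum>\<eta>\<in>X - Y. (if \<eta> \<in> X - X' then \<mu> \<eta> else 0) + \<mu> \<eta> * \<tau>)"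
    proof (rule sum_mono)
      fix \<eta> assume \<eta>: "\<eta> \<in> X - Y"
      show "\<mu> \<eta> * M \<eta> \<le> (if \<eta> \<in> X - X' then \<mu> \<eta> else 0) + \<mu> \<eta> * \<tau>"
      proof (cases "\<eta> \<in> X'")
        case True
        then have "M \<eta> \<le> \<tau>" using \<eta> by (auto simp: Y_def)
        then show ?thesis using True \<mu>(1) \<eta> by (auto intro: mult_left_mono)
      next
        case False
        then have "\<mu> \<eta> * M \<eta> \<le> \<mu> \<eta>" "0 \<le> \<mu> \<eta> * \<tau>"
          using M1 \<eta> \<mu>(1) \<tau> by (auto simp: mult_left_le)
        then show ?thesis using False \<eta> by simp
      qed
    qed
    also have "\<dots> \<le> (\<Sum>\<eta>\<in>X. (if \<eta> \<in> X - X' then \<mu> \<eta> else 0) + \<mu> \<eta> * \<tau>)"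
      using \<mu>(1) \<tau> X by (intro sum_mono2) auto
    also have "\<dots> = sum \<mu> (X - X') + sum \<mu> X * \<tau>"
      using X by (simp add: sum.distrib sum_distrib_right sum.If_cases set_diff_eq Collect_conj_eq)
    also have "\<dots> \<le> \<tau> + 1 * \<tau>"
      using \<mu> \<tau> by (intro add_mono mult_right_mono) auto
    finally have small_part: "(\<Sum>\<eta>\<in>X - Y. \<mu> \<eta> * M \<eta>) \<le> 2 * \<tau>" by simp
    \<comment> \<open>The single character \<open>\<xi>\<^sub>0\<close> carries enough weight: its
      diagonal value \<open>K = 1\<close> gives
      \<open>M \<xi>\<^sub>0 \<ge> \<mu> \<xi>\<^sub>0\<close>, whence the square in the
      hypothesis.\<close>
    have "\<mu> \<xi>\<^sub>0 \<le> M \<xi>\<^sub>0"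
      unfolding M_def using X \<mu>(1) K0 K_diag member_le_sum[of \<xi>\<^sub>0 X "\<lambda>\<xi>. \<mu> \<xi> * K \<xi> \<xi>\<^sub>0"] by simp
    then have "7 * \<tau> \<le> \<mu> \<xi>\<^sub>0 * M \<xi>\<^sub>0"
      using \<mu>(3) \<mu>(1)[OF X(3)] mult_left_mono[of "\<mu> \<xi>\<^sub>0" "M \<xi>\<^sub>0" "\<mu> \<xi>\<^sub>0"]
      unfolding power2_eq_square by linarith
    also have "\<mu> \<xi>\<^sub>0 * M \<xi>\<^sub>0 \<le> (\<Sum>\<eta>\<in>X. \<mu> \<eta> * M \<eta>)"
      using X \<mu>(1) M0 by (intro member_le_sum) auto
    also have "\<dots> = (\<Sum>\<eta>\<in>Y. \<mu> \<eta> * M \<eta>) + (\<Sum>\<eta>\<in>X - Y. \<mu> \<eta> * M \<eta>)"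
      by (simp add: sum.subset_diff[OF YX X(1)])
    finally have large: "7 * \<tau> \<le> (\<Sum>\<eta>\<in>Y. \<mu> \<eta> * M \<eta>) + (\<Sum>\<eta>\<in>X - Y. \<mu> \<eta> * M \<eta>)" .
    \<comment> \<open>With \<open>p\<close> the sum over \<open>Y\<close> and \<open>q\<close> the
      rest, \<open>p + q \<le> 3 * q \<le> 6 * \<tau>\<close>; this is where the factor 7 comes
      from.\<close>
    have "False" if "p / 2 \<le> q" "q \<le> 2 * \<tau>" "7 * \<tau> \<le> p + q" for p q :: real
      using that \<tau> by linarith
    from this[OF * small_part large] show False .
  qed
  moreover have "\<Theta> \<subseteq> X'" "real (card \<Theta>) \<le> 2 / \<tau>"
    using \<Theta> by (auto simp: Y_def)
  ultimately show thesis
    using that[of \<Theta>] by blast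
qed

section \<open>Fourier analysis on boxes of integer vectors\<close>

text \<open>Vectors are total functions padded by 0 rather than extensional ones, so that the
  pointwise \<open>+\<close>, \<open>-\<close> and \<open>0\<close> on functions serve as the group
  operations of Z^n.\<close>

definition box :: "nat \<Rightarrow> nat \<Rightarrow> (nat \<Rightarrow> int) set" where
  "box n N = {x. (\<forall>i<n. 0 \<le> x i \<and> x i < int N) \<and> (\<forall>i\<ge>n. x i = 0)}"

definition unit_vector :: "nat \<Rightarrow> nat \<Rightarrow> int" where
  "unit_vector i = (\<lambda>j. if j = i then 1 else 0)"

text \<open>The frequency \<open>\<xi> \<in> box n Q\<close> stands for the character \<open>g \<mapsto> exp(2\<pi>i \<langle>\<xi>, g\<rangle> / Q)\<close> of \<open>\<int>\<^sup>n\<close>; a vector of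
  \<open>\<int>\<^sup>n\<close> is a function on \<open>nat\<close> vanishing from \<open>n\<close> on.\<close>

definition box_char :: "nat \<Rightarrow> nat \<Rightarrow> (nat \<Rightarrow> int) \<Rightarrow> (nat \<Rightarrow> int) \<Rightarrow> complex" where
  "box_char n Q \<xi> g = (\<Prod>i<n. cis (2 * pi * (of_int (\<xi> i * g i) / of_nat Q)))"

text \<open>Exchanging padding by 0 for padding by \<open>undefined\<close> gives access to the
  counting and product rules for \<open>PiE\<close>.\<close>

lemma bij_betw_box: "bij_betw (\<lambda>x. restrict x {..<n}) (box n N) ({..<n} \<rightarrow>\<^sub>E {0..<int N})"
proof (rule bij_betw_byWitness[where f' = "\<lambda>x i. if i < n then x i else 0"], goal_cases)
  case 1
  show ?case by (auto simp: box_def)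
next
  case 2
  show ?case by (auto simp: PiE_def extensional_def restrict_def)
next
  case 3
  show ?case by (auto simp: box_def split: if_splits)
next
  case 4
  show ?case
  proof (rule image_subsetI)
    fix x assume "x \<in> {..<n} \<rightarrow>\<^sub>E {0..<int N}"
    then have "x i \<in> {0..<int N}" if "i < n" for i
      using PiE_mem[OF _ that[folded lessThan_iff]] by blast
    then show "(\<lambda>i. if i < n then x i else 0) \<in> box n N"
      by (simp add: box_def)
  qed
qed

lemma finite_box [simp]: "finite (box n N)"
  using bij_betw_finite[OF bij_betw_box[of n N]] by (simp add: finite_PiE)

lemma card_box [simp]: "card (box n N) = N ^ n"
  using bij_betw_same_card[OF bij_betw_box[of n N]] by (simp add: card_PiE)

lemma sum_prod_box:
  fixes f :: "nat \<Rightarrow> int \<Rightarrow> 'a::comm_semiring_1"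
  shows "(\<Sum>x\<in>box n N. \<Prod>i<n. f i (x i)) = (\<Prod>i<n. \<Sum>t\<in>{0..<int N}. f i t)"
  by (simp add: prod_sum_PiE sum.reindex_bij_betw[OF bij_betw_box, symmetric])

lemma zero_in_box: "N > 0 \<Longrightarrow> 0 \<in> box n N"
  by (simp add: box_def)

lemma cmod_box_char [simp]: "cmod (box_char n Q \<xi> g) = 1"
  by (simp add: box_char_def prod_norm[symmetric])

lemma box_char_add: "box_char n Q \<xi> (g + h) = box_char n Q \<xi> g * box_char n Q \<xi> h"
  by (simp add: box_char_def prod.distrib[symmetric] cis_mult ring_distribs add_divide_distrib)

lemma box_char_diff: "box_char n Q \<xi> (g - h) = box_char n Q \<xi> g * cnj (box_char n Q \<xi> h)"
  using char_diff[of "box_char n Q \<xi>"] by (simp add: box_char_add)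

lemma box_char_zero [simp]: "box_char n Q 0 g = 1" "box_char n Q \<xi> 0 = 1"
  by (simp_all add: box_char_def)

lemma box_char_unit_vector:
  assumes "i < n"
  shows "box_char n Q \<xi> (unit_vector i) = cis (2 * pi * (of_int (\<xi> i) / of_nat Q))"
proof -
  have "box_char n Q \<xi> (unit_vector i) =
      (\<Prod>j<n. if j = i then cis (2 * pi * (of_int (\<xi> i) / of_nat Q)) else 1)"
    unfolding box_char_def by (intro prod.cong) (auto simp: unit_vector_def)
  then show ?thesis
    using assms by simp
qed

lemma sum_cis_powers:
  "(\<Sum>t\<in>{0..<int N}. cis (of_int t * x)) = (\<Sum>t<N. cis x ^ t)"
proof -
  have "{0..<int N} = int ` {..<N}"
    by (simp add: lessThan_atLeast0 image_int_atLeastLessThan)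
  then show ?thesis
    by (simp add: sum.reindex Complex.DeMoivre)
qed

lemma cis_fraction_neq_1:
  assumes "m \<noteq> 0" "\<bar>m\<bar> < int Q"
  shows "cis (2 * pi * (of_int m / of_nat Q)) \<noteq> 1"
proof
  assume "cis (2 * pi * (of_int m / of_nat Q)) = 1"
  then have "cos (2 * pi * (of_int m / of_nat Q)) = 1"
    by (metis Re_complex_of_real cis.sel(1) of_real_1)
  then obtain k :: int where "2 * pi * (of_int m / of_nat Q) = of_int k * 2 * pi"
    using cos_one_2pi_int by blast
  moreover have "Q > 0" using assms by auto
  ultimately have "of_int m = (of_int (k * int Q) :: real)"
    by (simp add: field_simps)
  then have "m = k * int Q"
    by (simp only: of_int_eq_iff)
  with assms show False
    using zdvd_imp_le[of "int Q" "\<bar>m\<bar>"] by auto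
qed

text \<open>Orthogonality of characters. The sum factors over the coordinates, and a factor with
  \<open>g i \<noteq> 0\<close> is a full geometric sum over the powers of a \<open>Q\<close>-th
  root of unity other than 1, hence 0. The bound on \<open>g\<close> excludes nonzero multiples of
  \<open>Q\<close>.\<close>

lemma sum_box_char:
  assumes "\<And>i. i < n \<Longrightarrow> \<bar>g i\<bar> < int Q"
  shows "(\<Sum>\<xi>\<in>box n Q. box_char n Q \<xi> g) = (if \<forall>i<n. g i = 0 then of_nat (Q ^ n) else 0)"
proof -
  have one: "(\<Sum>t\<in>{0..<int Q}. cis (2 * pi * (of_int (t * m) / of_nat Q))) =
      (if m = 0 then of_nat Q else 0)" if m: "\<bar>m\<bar> < int Q" for m
  proof (cases "m = 0")
    case False
    define x where "x = 2 * pi * (of_int m / of_nat Q)"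
    have "Q > 0" using m by auto
    have "(\<Sum>t\<in>{0..<int Q}. cis (2 * pi * (of_int (t * m) / of_nat Q))) = (\<Sum>t<Q. cis x ^ t)"
      unfolding sum_cis_powers[symmetric] x_def by (simp add: mult_ac)
    also have "\<dots> = (cis x ^ Q - 1) / (cis x - 1)"
      using cis_fraction_neq_1[OF False m] by (simp add: geometric_sum x_def)
    also have "cis x ^ Q = cis (2 * pi * of_int m)"
      using \<open>Q > 0\<close> by (simp add: Complex.DeMoivre x_def)
    also have "\<dots> = 1"
      by (rule cis_multiple_2pi) simp
    finally show ?thesis
      using False by simp
  qed simp
  have "(\<Sum>\<xi>\<in>box n Q. box_char n Q \<xi> g) = (\<Prod>i<n. if g i = 0 then of_nat Q else 0)"
    unfolding box_char_def
    by (subst sum_prod_box[where f = "\<lambda>i t. cis (2 * pi * (of_int (t * g i) / of_nat Q))"])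
      (intro prod.cong refl one assms, simp)
  then show ?thesis
    by auto
qed

text \<open>The squared Fourier coefficient modulo \<open>Q\<close> of the indicator function of
  \<open>A\<close>, normalised so that the weights add up to the density of \<open>A\<close> in
  \<open>box n N\<close> (see \<open>sum_spectral_weight\<close>).\<close>

definition spectral_weight :: "nat \<Rightarrow> nat \<Rightarrow> nat \<Rightarrow> (nat \<Rightarrow> int) set \<Rightarrow> (nat \<Rightarrow> int) \<Rightarrow> real" where
  "spectral_weight n N Q A \<xi> = (cmod (\<Sum>x\<in>A. box_char n Q \<xi> x))\<^sup>2 / (real N ^ n * real Q ^ n)"

text \<open>Taking \<open>Q\<close> larger than \<open>N\<close> by the size of \<open>g\<close> prevents wrap-around modulo \<open>Q\<close>.\<close>

lemma correlation_spectral: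
  assumes A: "A \<subseteq> box n N" and Q: "Q > 0"
    and g: "\<And>i. i < n \<Longrightarrow> int N + \<bar>g i\<bar> \<le> int Q" "\<And>i. i \<ge> n \<Longrightarrow> g i = 0"
  shows "(\<Sum>\<xi>\<in>box n Q. of_real (spectral_weight n N Q A \<xi>) * box_char n Q \<xi> g) =
    of_nat (card {y\<in>A. y + g \<in> A}) / of_nat N ^ n"
proof -
  have fin: "finite A" by (rule finite_subset[OF A finite_box])
  have inner: "(\<Sum>\<xi>\<in>box n Q. box_char n Q \<xi> (y + g - x)) = (if x = y + g then of_nat (Q ^ n) else 0)"
    if "x \<in> A" "y \<in> A" for x y
  proof -
    have xy: "x \<in> box n N" "y \<in> box n N" using that A by auto
    have "\<bar>(y + g - x) i\<bar> < int Q" if i: "i < n" for i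
    proof -
      have "0 \<le> x i" "x i < int N" "0 \<le> y i" "y i < int N"
        using xy i unfolding box_def by blast+
      then show ?thesis
        using g(1)[OF i] by simp
    qed
    moreover have "(\<forall>i<n. (y + g - x) i = 0) \<longleftrightarrow> x = y + g"
    proof -
      have "x i = (y + g) i" if "\<not> i < n" for i
        using xy g(2)[of i] that by (simp add: box_def)
      then show ?thesis
        unfolding fun_eq_iff by (metis eq_iff_diff_eq_0 minus_apply)
    qed
    ultimately show ?thesis
      using sum_box_char[of n "y + g - x" Q] by simp
  qed
  have "(\<Sum>\<xi>\<in>box n Q. of_real ((cmod (\<Sum>x\<in>A. box_char n Q \<xi> x))\<^sup>2) * box_char n Q \<xi> g) =
      (\<Sum>\<xi>\<in>box n Q. \<Sum>y\<in>A. \<Sum>x\<in>A. box_char n Q \<xi> (y + g - x))"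
    unfolding complex_norm_square cnj_sum sum_product sum_distrib_right
    by (simp add: box_char_diff box_char_add sum_distrib_left mult_ac)
  also have "\<dots> = (\<Sum>y\<in>A. \<Sum>x\<in>A. \<Sum>\<xi>\<in>box n Q. box_char n Q \<xi> (y + g - x))"
    by (rule trans[OF sum.swap sum.cong[OF refl sum.swap]])
  also have "\<dots> = (\<Sum>y\<in>A. if y + g \<in> A then of_nat (Q ^ n) else 0)"
    using fin by (simp add: inner sum.delta)
  also have "\<dots> = of_nat (card {y\<in>A. y + g \<in> A}) * of_nat Q ^ n"
    using fin by (simp add: sum.If_cases Int_def)
  finally show ?thesis
    using Q by (simp add: spectral_weight_def sum_divide_distrib[symmetric] field_simps)
qed

section \<open>Quantitative estimates on boxes and Bogolyubov's theorem for Z^n\<close>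

lemma cmod_geometric_sum_le:
  assumes "cmod z = 1" "z \<noteq> 1"
  shows "cmod (\<Sum>t<N. z ^ t) \<le> 2 / cmod (z - 1)"
proof -
  have "cmod (z ^ N - 1) \<le> 2"
    using norm_triangle_ineq4[of "z ^ N" 1] assms by (simp add: norm_power)
  then show ?thesis
    using assms by (simp add: geometric_sum norm_divide divide_right_mono)
qed

text \<open>The average is a product of averaged geometric sums, one per coordinate. At coordinate
  \<open>i\<close> the ratio of the two characters is more than 1/8 away from 1, so that geometric
  sum is at most 16; every other factor is at most 1.\<close>

lemma box_average_small:
  assumes i: "i < n" and far: "cmod (box_char n Q \<xi> (unit_vector i) - box_char n Q \<eta> (unit_vector i)) > 1/8"
    and R: "R > 0"
  shows "cmod ((\<Sum>a\<in>box n R. box_char n Q \<xi> a * cnj (box_char n Q \<eta> a)) / of_nat (card (box n R))) \<le> 16 / real R"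
proof -
  define z where "z i = cis (2 * pi * (of_int (\<xi> i) / of_nat Q)) * cnj (cis (2 * pi * (of_int (\<eta> i) / of_nat Q)))" for i
  have z1: "cmod (z i) = 1" for i by (simp add: z_def norm_mult)
  have z_eq: "z i = cis (2 * pi * (of_int (\<xi> i - \<eta> i) / of_nat Q))" for i
    by (simp add: z_def cis_cnj cis_mult diff_divide_distrib ring_distribs)
  have far': "1/8 < cmod (z i - 1)"
  proof -
    have "cis x * cnj (cis y) - 1 = (cis x - cis y) * cnj (cis y)" for x y
      by (simp add: ring_distribs complex_norm_square[symmetric])
    then show ?thesis
      using far by (simp add: z_def box_char_unit_vector[OF i] norm_mult)
  qed
  have "(\<Sum>a\<in>box n R. box_char n Q \<xi> a * cnj (box_char n Q \<eta> a)) =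
      (\<Sum>a\<in>box n R. \<Prod>i<n. cis (of_int (a i) * (2 * pi * (of_int (\<xi> i - \<eta> i) / of_nat Q))))"
    by (simp add: box_char_def prod.distrib[symmetric] cis_cnj cis_mult diff_divide_distrib ring_distribs mult_ac)
  also have "\<dots> = (\<Prod>i<n. \<Sum>t<R. z i ^ t)"
    by (subst sum_prod_box) (simp only: sum_cis_powers z_eq)
  finally have eq: "(\<Sum>a\<in>box n R. box_char n Q \<xi> a * cnj (box_char n Q \<eta> a)) / of_nat (card (box n R))
      = (\<Prod>i<n. (\<Sum>t<R. z i ^ t) / of_nat R)"
    by (simp add: prod_dividef)
  have le1: "cmod ((\<Sum>t<R. z j ^ t) / of_nat R) \<le> 1" for j
    using sum_norm_le[of "{..<R}" "\<lambda>t. z j ^ t" "\<lambda>_. 1"] R by (simp add: norm_power z1 norm_divide)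
  have "cmod (\<Prod>j<n. (\<Sum>t<R. z j ^ t) / of_nat R) =
      cmod ((\<Sum>t<R. z i ^ t) / of_nat R) * (\<Prod>j\<in>{..<n} - {i}. cmod ((\<Sum>t<R. z j ^ t) / of_nat R))"
    unfolding prod_norm norm_mult[symmetric] using i by (subst prod.remove[of _ i]) auto
  also have "\<dots> \<le> cmod ((\<Sum>t<R. z i ^ t) / of_nat R) * 1"
    by (intro mult_left_mono prod_le_1) (use le1 in auto)
  also have "\<dots> \<le> 16 / real R"
  proof -
    have "cmod (\<Sum>t<R. z i ^ t) \<le> 2 / cmod (z i - 1)"
      using far' by (intro cmod_geometric_sum_le) (auto simp: z1)
    also have "\<dots> \<le> 16"
      using far' by (simp add: divide_le_eq)
    finally show ?thesis
      by (simp add: norm_divide divide_right_mono)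
  qed
  finally show ?thesis
    unfolding eq .
qed

lemma sum_spectral_weight:
  assumes "A \<subseteq> box n N" "Q > 0" "N \<le> Q"
  shows "sum (spectral_weight n N Q A) (box n Q) = real (card A) / real N ^ n"
proof -
  have "of_real (sum (spectral_weight n N Q A) (box n Q)) = (of_real (real (card A) / real N ^ n) :: complex)"
    using correlation_spectral[OF assms(1,2), of 0] assms(3) by simp
  then show ?thesis
    by (simp only: of_real_eq_iff)
qed

text \<open>Real part of the correlation identity at shift 0 minus that at shift \<open>g\<close>.
  If \<open>A\<close> is nearly invariant under \<open>g\<close>, little mass can sit on characters
  whose value at \<open>g\<close> is far from 1.\<close>

lemma sum_spectral_weight_defect:
  assumes A: "A \<subseteq> box n N" "Q > 0"
    and g: "\<And>i. i < n \<Longrightarrow> int N + \<bar>g i\<bar> \<le> int Q" "\<And>i. i \<ge> n \<Longrightarrow> g i = 0" and "N \<le> Q"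
  shows "(\<Sum>\<xi>\<in>box n Q. spectral_weight n N Q A \<xi> * (1 - Re (box_char n Q \<xi> g))) =
    real (card {y\<in>A. y + g \<notin> A}) / real N ^ n"
proof -
  have fin: "finite A" by (rule finite_subset[OF A(1) finite_box])
  have corr: "(\<Sum>\<xi>\<in>box n Q. of_real (spectral_weight n N Q A \<xi>) * box_char n Q \<xi> g) =
      of_real (real (card {y\<in>A. y + g \<in> A}) / real N ^ n)"
    using correlation_spectral[OF A g] by simp
  have "(\<Sum>\<xi>\<in>box n Q. spectral_weight n N Q A \<xi> * Re (box_char n Q \<xi> g)) =
      Re (\<Sum>\<xi>\<in>box n Q. of_real (spectral_weight n N Q A \<xi>) * box_char n Q \<xi> g)"
    by simp
  also have "\<dots> = real (card {y\<in>A. y + g \<in> A}) / real N ^ n"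
    unfolding corr by (rule Re_complex_of_real)
  finally have "(\<Sum>\<xi>\<in>box n Q. spectral_weight n N Q A \<xi> * (1 - Re (box_char n Q \<xi> g))) =
      real (card A) / real N ^ n - real (card {y\<in>A. y + g \<in> A}) / real N ^ n"
    using sum_spectral_weight[OF A assms(5)] by (simp add: ring_distribs sum_subtractf)
  moreover have "{y\<in>A. y + g \<notin> A} = A - {y\<in>A. y + g \<in> A}"
    by blast
  then have "real (card {y\<in>A. y + g \<notin> A}) = real (card A) - real (card {y\<in>A. y + g \<in> A})"
    using fin by (simp add: card_Diff_subset card_mono of_nat_diff)
  ultimately show ?thesis
    by (simp add: diff_divide_distrib)
qed

text \<open>Points far enough from all faces stay in the box. They include a translate of
  \<open>box n (N - 6)\<close> by 3 in each of the first \<open>n\<close> coordinates, and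
  Bernoulli's inequality bounds the proportion of the rest.\<close>

lemma card_box_boundary:
  assumes l: "\<And>i. \<bar>l i\<bar> \<le> 3" "\<And>i. i \<ge> n \<Longrightarrow> l i = 0" and N: "N \<ge> 6"
  shows "real (card {y\<in>box n N. y + l \<notin> box n N}) / real N ^ n \<le> 6 * real n / real N"
proof -
  let ?I = "{y\<in>box n N. y + l \<in> box n N}"
  define s :: "nat \<Rightarrow> int" where "s = (\<lambda>i. if i < n then 3 else 0)"
  have "inj_on (\<lambda>y. y + s) (box n (N - 6))"
    by (simp add: inj_on_def)
  moreover have "y + s \<in> ?I" if "y \<in> box n (N - 6)" for y
  proof -
    have y: "0 \<le> y i" "y i < int N - 6" if "i < n" for i
      using \<open>y \<in> box n (N - 6)\<close> that N by (auto simp: box_def)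
    moreover have "- 3 \<le> l i" "l i \<le> 3" for i
      using l(1)[of i] by auto
    ultimately have "0 \<le> y i + 3 + l i" "y i + 3 + l i < int N" if "i < n" for i
      using that by (smt (verit))+
    moreover have "y i = 0" if "i \<ge> n" for i
      using \<open>y \<in> box n (N - 6)\<close> that by (simp add: box_def)
    ultimately show ?thesis
      using l(2) y by (force simp: box_def s_def)
  qed
  ultimately have "card (box n (N - 6)) \<le> card ?I"
    by (intro card_inj_on_le[of "\<lambda>y. y + s"]) auto
  moreover have "(real N - 6) ^ n = real ((N - 6) ^ n)"
    using N by (simp add: of_nat_diff)
  ultimately have I: "(real N - 6) ^ n \<le> real (card ?I)"
    by simp
  have "{y\<in>box n N. y + l \<notin> box n N} = box n N - ?I"
    by blast
  then have "real (card {y\<in>box n N. y + l \<notin> box n N}) = real N ^ n - real (card ?I)"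
    using card_mono[of "box n N" ?I] by (simp add: card_Diff_subset of_nat_diff)
  also have "\<dots> \<le> real N ^ n - (real N - 6) ^ n"
    using I by simp
  finally have "real (card {y\<in>box n N. y + l \<notin> box n N}) / real N ^ n \<le> 1 - ((real N - 6) / real N) ^ n"
    using N by (simp add: field_simps)
  also have "\<dots> = 1 - (1 + - (6 / real N)) ^ n"
    using N by (simp add: diff_divide_distrib)
  also have "\<dots> \<le> real n * (6 / real N)"
    using Bernoulli_inequality[of "- (6 / real N)" n] N by simp
  finally show ?thesis
    by (simp add: mult_ac)
qed

lemma large_colour_class:
  fixes c :: "'x \<Rightarrow> nat"
  assumes "finite B" "\<And>x. x \<in> B \<Longrightarrow> c x < k" "k > 0"
  shows "\<exists>j. real (card B) \<le> real k * real (card {x\<in>B. c x = j})"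
proof (rule ccontr)
  assume "\<not> ?thesis"
  then have neg: "real k * real (card {x\<in>B. c x = j}) < real (card B)" for j
    by (simp add: not_le)
  have "c ` B \<subseteq> {..<k}"
    using assms(2) by auto
  then have "card B = (\<Sum>j<k. card {x\<in>B. c x = j})"
    using sum.group[of B "{..<k}" c "\<lambda>_. 1::nat"] assms(1) by simp
  then have "real k * real (card B) = (\<Sum>j<k. real k * real (card {x\<in>B. c x = j}))"
    by (simp add: sum_distrib_left)
  also have "\<dots> < (\<Sum>j<k. real (card B))"
    using neg assms(3) by (intro sum_strict_mono) auto
  finally show False
    by simp
qed

text \<open>\<open>\<Lambda>\<close> stands for relations of a group presented as a quotient of Z^n.
  The number of characters is bounded in terms of \<open>k\<close> alone, whatever \<open>n\<close>,
  \<open>\<Lambda>\<close> and \<open>\<gamma>\<close>; this is what lets \<open>n\<close> tend to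
  infinity later.\<close>

lemma Bogolyubov_lattice:
  fixes c :: "(nat \<Rightarrow> int) \<Rightarrow> nat" and \<gamma> :: real
  assumes k: "k > 0" "\<And>x. c x < k" and \<gamma>: "\<gamma> > 0"
    and \<Lambda>: "finite \<Lambda>" "\<And>l x. l \<in> \<Lambda> \<Longrightarrow> c (x + l) = c x" "\<And>l i. l \<in> \<Lambda> \<Longrightarrow> \<bar>l i\<bar> \<le> 3"
      "\<And>l i. l \<in> \<Lambda> \<Longrightarrow> i \<ge> n \<Longrightarrow> l i = 0"
  obtains \<Theta> :: "((nat \<Rightarrow> int) \<Rightarrow> complex) set"
  where "finite \<Theta>" "card \<Theta> \<le> 56 * k ^ 4"
    "\<And>\<theta> g. \<theta> \<in> \<Theta> \<Longrightarrow> cmod (\<theta> g) = 1" "\<And>\<theta> g h. \<theta> \<in> \<Theta> \<Longrightarrow> \<theta> (g + h) = \<theta> g * \<theta> h"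
    "\<And>\<theta> l. \<theta> \<in> \<Theta> \<Longrightarrow> l \<in> \<Lambda> \<Longrightarrow> cmod (\<theta> l - 1) \<le> \<gamma>"
    "\<And>i. i < n \<Longrightarrow> (\<And>\<theta>. \<theta> \<in> \<Theta> \<Longrightarrow> cmod (\<theta> (unit_vector i) - 1) \<le> 1/4) \<Longrightarrow>
      \<exists>w x y z. c w = c x \<and> c w = c y \<and> c w = c z \<and> (w - x) - (y - z) = unit_vector i"
proof -
  \<comment> \<open>A colour class of density at least \<open>1 / k\<close> gives the trivial
    character a weight of at least \<open>1 / (2 * k ^ 2)\<close>, whose square is
    \<open>7 * \<tau>\<close>.\<close>
  define \<tau> where "\<tau> = 1 / (28 * real k ^ 4)"
  have k1: "1 \<le> real k" "1 \<le> real k ^ 4"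
    using k(1) by simp_all
  then have \<tau>: "0 < \<tau>" "\<tau> \<le> 1"
    unfolding \<tau>_def by (simp, subst divide_le_eq_1_pos, linarith+)
  \<comment> \<open>This makes \<open>16 / R < \<tau> / 2\<close>, so characters far apart at a unit
    vector correlate by less than \<open>\<tau> / 2\<close> over \<open>box n R\<close>.\<close>
  obtain R :: nat where R: "32 / \<tau> < real R"
    using reals_Archimedean2 by blast
  have "32 \<le> 32 / \<tau>"
    using \<tau> by (simp add: le_divide_eq)
  then have R32: "R \<ge> 32" using R by linarith
  \<comment> \<open>The three summands serve, in this order, the boundary estimate, the bound
    \<open>(N / Q) ^ n \<ge> 1 / 2\<close>, and the bound \<open>\<tau>\<close> on the mass outside
    \<open>X'\<close>.\<close>
  obtain N :: nat where N: "6 + 2 * real n * real R + 12 * real n * real (card \<Lambda>) / (\<gamma>\<^sup>2 * \<tau>) < real N"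
    using reals_Archimedean2 by blast
  have N_parts: "0 \<le> 2 * real n * real R" "0 \<le> 12 * real n * real (card \<Lambda>) / (\<gamma>\<^sup>2 * \<tau>)"
    using \<tau> by simp_all
  then have N6: "N \<ge> 6" and N_R: "2 * real n * real R < real N"
    and N_\<Lambda>: "12 * real n * real (card \<Lambda>) / (\<gamma>\<^sup>2 * \<tau>) < real N"
    using N by linarith+
  \<comment> \<open>The margin \<open>R\<close> prevents wrap-around for all shifts with entries up
    to \<open>R\<close>.\<close>
  define Q where "Q = N + R"
  have Q: "Q > 0" "N \<le> Q" using N6 by (auto simp: Q_def)
  obtain j where j: "real (card (box n N)) \<le> real k * real (card {x\<in>box n N. c x = j})"
    using large_colour_class[of "box n N" c k] k by auto
  define A where "A = {x\<in>box n N. c x = j}"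
  have A: "A \<subseteq> box n N" by (auto simp: A_def)
  have finA: "finite A" by (rule finite_subset[OF A finite_box])
  define \<delta> where "\<delta> = real (card A) / real N ^ n"
  have \<delta>: "1 / real k \<le> \<delta>" "\<delta> \<le> 1"
  proof -
    show "1 / real k \<le> \<delta>"
      using j k(1) N6 by (simp add: \<delta>_def A_def field_simps)
    have "card A \<le> card (box n N)"
      by (rule card_mono[OF finite_box A])
    then show "\<delta> \<le> 1"
      using N6 by (simp add: \<delta>_def divide_le_eq flip: of_nat_power)
  qed
  let ?X = "box n Q" and ?\<mu> = "spectral_weight n N Q A" and ?ch = "box_char n Q"
  define X' where "X' = {\<xi> \<in> ?X. \<forall>l\<in>\<Lambda>. cmod (?ch \<xi> l - 1) \<le> \<gamma>}"
  have \<mu>_nonneg: "0 \<le> ?\<mu> \<xi>" for \<xi>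
    by (simp add: spectral_weight_def)
  have \<mu>_sum: "sum ?\<mu> ?X \<le> 1"
    using sum_spectral_weight[OF A Q] \<delta> by (simp add: \<delta>_def)
  have \<mu>_0: "7 * \<tau> \<le> (?\<mu> 0)\<^sup>2"
  proof -
    have "2 * real n * real R \<le> real Q"
      using N_R by (simp add: Q_def)
    then have "1 / 2 \<le> 1 + real n * (- (real R / real Q))"
      using Q by (simp add: field_simps)
    also have "\<dots> \<le> (1 + - (real R / real Q)) ^ n"
      using Q by (intro Bernoulli_inequality) (simp add: Q_def divide_le_eq)
    also have "1 + - (real R / real Q) = real N / real Q"
    proof -
      have "real N = real Q - real R"
        by (simp add: Q_def)
      then show ?thesis
        using Q(1) by (simp add: diff_divide_distrib)
    qed
    finally have half: "1 / 2 \<le> (real N / real Q) ^ n" .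
    have "?\<mu> 0 = \<delta>\<^sup>2 * (real N / real Q) ^ n"
      using N6 Q by (simp add: spectral_weight_def \<delta>_def power_divide power2_eq_square)
    also have "\<dots> \<ge> (1 / real k)\<^sup>2 * (1 / 2)"
      using \<delta> half by (intro mult_mono power_mono) auto
    finally have "((1 / real k)\<^sup>2 * (1 / 2))\<^sup>2 \<le> (?\<mu> 0)\<^sup>2"
      by (intro power_mono) auto
    moreover have "((1 / real k)\<^sup>2 * (1 / 2))\<^sup>2 = 7 * \<tau>"
      by (simp add: \<tau>_def power2_eq_square power4_eq_xxxx)
    ultimately show ?thesis by simp
  qed
  \<comment> \<open>Markov's inequality: a character outside \<open>X'\<close> satisfies
    \<open>1 - Re (?ch \<xi> l) \<ge> \<gamma>\<^sup>2 / 2\<close> for some \<open>l\<close> in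
    \<open>\<Lambda>\<close>, while for each \<open>l\<close> the weighted sum of this quantity is
    at most the boundary loss.\<close>
  have \<mu>_bad: "sum ?\<mu> (?X - X') \<le> \<tau>"
  proof -
    have per_l: "(\<Sum>\<xi>\<in>?X. ?\<mu> \<xi> * (1 - Re (?ch \<xi> l))) \<le> 6 * real n / real N" if l: "l \<in> \<Lambda>" for l
    proof -
      have "int N + \<bar>l i\<bar> \<le> int Q" for i
        using \<Lambda>(3)[OF l, of i] R32 by (simp add: Q_def)
      then have "(\<Sum>\<xi>\<in>?X. ?\<mu> \<xi> * (1 - Re (?ch \<xi> l))) = real (card {y\<in>A. y + l \<notin> A}) / real N ^ n"
        using \<Lambda>(4)[OF l] by (intro sum_spectral_weight_defect A Q) auto
      also have "\<dots> \<le> real (card {y\<in>box n N. y + l \<notin> box n N}) / real N ^ n"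
      proof (intro divide_right_mono of_nat_mono card_mono)
        \<comment> \<open>As \<open>c\<close> is invariant under \<open>l\<close>, a point can leave
          \<open>A\<close> only by leaving the box.\<close>
        show "{y\<in>A. y + l \<notin> A} \<subseteq> {y\<in>box n N. y + l \<notin> box n N}"
          using \<Lambda>(2)[OF l] by (auto simp: A_def)
      qed simp_all
      also have "\<dots> \<le> 6 * real n / real N"
        using \<Lambda>(3,4)[OF l] N6 by (intro card_box_boundary) auto
      finally show ?thesis .
    qed
    have term_nonneg: "0 \<le> 2 / \<gamma>\<^sup>2 * (?\<mu> \<xi> * (1 - Re (?ch \<xi> l)))" for \<xi> l
      using \<mu>_nonneg complex_Re_le_cmod[of "?ch \<xi> l"] by simp
    have "sum ?\<mu> (?X - X') \<le> (\<Sum>\<xi>\<in>?X - X'. \<Sum>l\<in>\<Lambda>. 2 / \<gamma>\<^sup>2 * (?\<mu> \<xi> * (1 - Re (?ch \<xi> l))))"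
    proof (rule sum_mono)
      fix \<xi> assume "\<xi> \<in> ?X - X'"
      then obtain l where l: "l \<in> \<Lambda>" "\<gamma> < cmod (?ch \<xi> l - 1)"
        by (auto simp: X'_def not_le)
      have "(cmod (?ch \<xi> l - 1))\<^sup>2 = 2 * (1 - Re (?ch \<xi> l))"
        using cmod_box_char[of n Q \<xi> l] 
        by (simp add: cmod_power2 power2_diff del: cmod_box_char) (simp add: cmod_def)
      then have "\<gamma>\<^sup>2 \<le> 2 * (1 - Re (?ch \<xi> l))"
        using l(2) \<gamma> power_mono[of \<gamma> "cmod (?ch \<xi> l - 1)" 2] by simp
      then have "?\<mu> \<xi> * 1 \<le> ?\<mu> \<xi> * (2 / \<gamma>\<^sup>2 * (1 - Re (?ch \<xi> l)))"
        using \<gamma> by (intro mult_left_mono \<mu>_nonneg) (simp add: field_simps)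
      also have "\<dots> = 2 / \<gamma>\<^sup>2 * (?\<mu> \<xi> * (1 - Re (?ch \<xi> l)))"
        by (simp add: mult_ac)
      also have "\<dots> \<le> (\<Sum>l\<in>\<Lambda>. 2 / \<gamma>\<^sup>2 * (?\<mu> \<xi> * (1 - Re (?ch \<xi> l))))"
        by (intro member_le_sum l(1) \<Lambda>(1) term_nonneg)
      finally show "?\<mu> \<xi> \<le> (\<Sum>l\<in>\<Lambda>. 2 / \<gamma>\<^sup>2 * (?\<mu> \<xi> * (1 - Re (?ch \<xi> l))))"
        by simp
    qed
    also have "\<dots> \<le> (\<Sum>\<xi>\<in>?X. \<Sum>l\<in>\<Lambda>. 2 / \<gamma>\<^sup>2 * (?\<mu> \<xi> * (1 - Re (?ch \<xi> l))))"
      by (intro sum_mono2 sum_nonneg term_nonneg) auto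
    also have "\<dots> = (\<Sum>l\<in>\<Lambda>. 2 / \<gamma>\<^sup>2 * (\<Sum>\<xi>\<in>?X. ?\<mu> \<xi> * (1 - Re (?ch \<xi> l))))"
      unfolding sum_distrib_left by (rule sum.swap)
    also have "\<dots> \<le> (\<Sum>l\<in>\<Lambda>. 2 / \<gamma>\<^sup>2 * (6 * real n / real N))"
      using per_l by (intro sum_mono mult_left_mono) auto
    also have "\<dots> = 12 * real n * real (card \<Lambda>) / (\<gamma>\<^sup>2 * real N)"
      by simp
    also have "\<dots> \<le> \<tau>"
      using N_\<Lambda> \<tau> \<gamma> N6 by (simp add: field_simps)
    finally show ?thesis .
  qed
  have close: "cmod (?ch \<xi> t - ?ch \<eta> t) \<le> 1/8"
    if t: "t \<in> unit_vector ` {..<n}" and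
      K: "\<tau> / 2 \<le> (cmod ((\<Sum>a\<in>box n R. ?ch \<xi> a * cnj (?ch \<eta> a)) / of_nat (card (box n R))))\<^sup>2" for \<xi> \<eta> t
  proof (rule ccontr)
    assume far: "\<not> ?thesis"
    obtain i where i: "i < n" "t = unit_vector i" using t by auto
    have "cmod ((\<Sum>a\<in>box n R. ?ch \<xi> a * cnj (?ch \<eta> a)) / of_nat (card (box n R))) \<le> 16 / real R"
      using far R32 i by (intro box_average_small) auto
    then have "(cmod ((\<Sum>a\<in>box n R. ?ch \<xi> a * cnj (?ch \<eta> a)) / of_nat (card (box n R))))\<^sup>2 \<le> (16 / real R)\<^sup>2"
      by (intro power_mono) auto
    also have "\<dots> \<le> 16 / real R"
      using R32 by (intro power_le_one_iff[THEN iffD2, THEN order_trans] power2_eq_square[THEN ord_eq_le_trans] mult_left_le) auto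
    also have "\<dots> < \<tau> / 2"
      using R R32 \<tau> by (simp add: field_simps)
    finally show False using K by simp
  qed
  obtain \<Theta> where \<Theta>: "\<Theta> \<subseteq> X'" "real (card \<Theta>) \<le> 2 / \<tau>"
    and \<Theta>_test: "\<And>t. t \<in> unit_vector ` {..<n} \<Longrightarrow> (\<And>\<theta>. \<theta> \<in> \<Theta> \<Longrightarrow> cmod (?ch \<theta> t - 1) \<le> 1/4) \<Longrightarrow>
      \<exists>a\<in>box n R. \<exists>b\<in>box n R. (\<Sum>\<xi>\<in>?X. of_real (?\<mu> \<xi>) * ?ch \<xi> (a - b)) \<noteq> 0 \<and>
        (\<Sum>\<xi>\<in>?X. of_real (?\<mu> \<xi>) * ?ch \<xi> (t - (a - b))) \<noteq> 0"
  proof (rule few_characters_suffice[of ?X X' 0 ?ch ?\<mu> \<tau> "box n R" "unit_vector ` {..<n}"])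
    show "finite ?X" by simp
    show "X' \<subseteq> ?X" by (auto simp: X'_def)
    show "0 \<in> ?X" using Q by (simp add: zero_in_box)
    show "box n R \<noteq> {}" using zero_in_box[of R n] R32 by auto
  qed (use \<mu>_nonneg \<mu>_sum \<mu>_0 \<mu>_bad \<tau> close in \<open>simp_all add: box_char_add\<close>)
  have fin\<Theta>: "finite \<Theta>"
    using \<Theta>(1) by (rule finite_subset) (simp add: X'_def)
  have differ: "\<exists>x y. c x = j \<and> c y = j \<and> x - y = g"
    if nz: "(\<Sum>\<xi>\<in>?X. of_real (?\<mu> \<xi>) * ?ch \<xi> g) \<noteq> 0"
      and g: "\<And>i. i < n \<Longrightarrow> \<bar>g i\<bar> \<le> int R" "\<And>i. i \<ge> n \<Longrightarrow> g i = 0" for g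
  proof -
    have "card {y\<in>A. y + g \<in> A} \<noteq> 0"
    proof
      assume "card {y\<in>A. y + g \<in> A} = 0"
      then have "(\<Sum>\<xi>\<in>?X. of_real (?\<mu> \<xi>) * ?ch \<xi> g) = 0"
        using g by (subst correlation_spectral[OF A Q(1)]) (simp_all add: Q_def)
      with nz show False by contradiction
    qed
    then have "{y\<in>A. y + g \<in> A} \<noteq> {}"
      by (metis card.empty)
    then obtain y where "y \<in> A" "y + g \<in> A" by blast
    then show ?thesis
      by (intro exI[of _ "y + g"] exI[of _ y]) (simp add: A_def)
  qed
  show thesis
  proof (rule that[of "?ch ` \<Theta>"])
    show "finite (?ch ` \<Theta>)" using fin\<Theta> by simp
    have "real (card (?ch ` \<Theta>)) \<le> real (card \<Theta>)"
      using card_image_le[OF fin\<Theta>] by simp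
    also have "\<dots> \<le> real (56 * k ^ 4)"
      using \<Theta>(2) by (simp add: \<tau>_def)
    finally show "card (?ch ` \<Theta>) \<le> 56 * k ^ 4"
      by (simp only: of_nat_le_iff)
    show "cmod (\<theta> g) = 1" if "\<theta> \<in> ?ch ` \<Theta>" for \<theta> g
      using that by auto
    show "\<theta> (g + h) = \<theta> g * \<theta> h" if "\<theta> \<in> ?ch ` \<Theta>" for \<theta> g h
      using that by (auto simp: box_char_add)
    show "cmod (\<theta> l - 1) \<le> \<gamma>" if "\<theta> \<in> ?ch ` \<Theta>" "l \<in> \<Lambda>" for \<theta> l
      using that \<Theta>(1) by (auto simp: X'_def)
    fix i assume i: "i < n" and small: "\<And>\<theta>. \<theta> \<in> ?ch ` \<Theta> \<Longrightarrow> cmod (\<theta> (unit_vector i) - 1) \<le> 1/4"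
    obtain a b where ab: "a \<in> box n R" "b \<in> box n R"
      and nz: "(\<Sum>\<xi>\<in>?X. of_real (?\<mu> \<xi>) * ?ch \<xi> (a - b)) \<noteq> 0"
        "(\<Sum>\<xi>\<in>?X. of_real (?\<mu> \<xi>) * ?ch \<xi> (unit_vector i - (a - b))) \<noteq> 0"
      using \<Theta>_test[of "unit_vector i"] i small by blast
    have bounds: "0 \<le> a m" "a m < int R" "0 \<le> b m" "b m < int R" if "m < n" for m
      using ab that unfolding box_def by blast+
    have zeros: "a m = 0" "b m = 0" if "m \<ge> n" for m
      using ab that unfolding box_def by blast+
    obtain w x where wx: "c w = j" "c x = j" "w - x = a - b"
      using differ[OF nz(1)] bounds zeros by (fastforce simp: abs_le_iff)
    \<comment> \<open>The entries of \<open>a - b\<close> are at most \<open>R - 1\<close> in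
      absolute value; the unit vector uses up the remaining 1.\<close>
    have "\<bar>(unit_vector i - (a - b)) m\<bar> \<le> int R" if "m < n" for m
      using bounds[OF that] by (auto simp: unit_vector_def)
    moreover have "(unit_vector i - (a - b)) m = 0" if "m \<ge> n" for m
      using zeros[OF that] i that by (simp add: unit_vector_def)
    ultimately obtain z y where zy: "c z = j" "c y = j" "z - y = unit_vector i - (a - b)"
      using differ[OF nz(2)] by blast
    have "(w - x) - (y - z) = (w - x) + (z - y)" by simp
    also have "\<dots> = unit_vector i" unfolding wx zy by simp
    finally show "\<exists>w x y z. c w = c x \<and> c w = c y \<and> c w = c z \<and> (w - x) - (y - z) = unit_vector i"
      using wx zy by metis
  qed
qed

section \<open>Characters of a countable abelian group\<close>

text \<open>A countable product of circles is compact by Tychonoff and first countable, hence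
  sequentially compact, so one subsequence serves all indices at once.\<close>

lemma compact_circle_family:
  fixes t :: "nat \<Rightarrow> nat \<times> nat \<Rightarrow> complex"
  assumes "\<And>n p. cmod (t n p) = 1"
  shows "\<exists>l (r :: nat \<Rightarrow> nat). strict_mono r \<and> (\<forall>p. cmod (l p) = 1 \<and> (\<lambda>n. t (r n) p) \<longlonglongrightarrow> l p)"
proof -
  let ?S = "(UNIV :: (nat \<times> nat) set) \<rightarrow>\<^sub>E sphere (0 :: complex) 1"
  have "compactin (product_topology (\<lambda>_. euclidean) UNIV) ?S"
    by (simp add: compactin_PiE)
  then have "seq_compact ?S"
    by (simp add: euclidean_product_topology compact_imp_seq_compact)
  moreover have "t n \<in> ?S" for n
    using assms by (simp add: PiE_iff)
  ultimately obtain l r where l: "l \<in> ?S" "strict_mono r" "(t \<circ> r) \<longlonglongrightarrow> l"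
    unfolding seq_compact_def by metis
  have "(\<lambda>n. t (r n) p) \<longlonglongrightarrow> l p" for p
  proof -
    have "(\<lambda>n. (t \<circ> r) n p) \<longlonglongrightarrow> l p"
      using continuous_on_tendsto_compose[OF continuous_on_product_coordinates l(3), of p] by simp
    then show ?thesis by simp
  qed
  moreover have "cmod (l p) = 1" for p
    using l(1) by (cases p) (simp add: PiE_iff)
  ultimately show ?thesis
    using l(2) by (intro exI[of _ l] exI[of _ r]) simp
qed

text \<open>Listing with repetitions lets families of different sizes share the index range
  \<open>{..<m}\<close>.\<close>

lemma finite_enumerated_below:
  assumes "finite A" "A \<noteq> {}" "card A \<le> m"
  obtains f :: "nat \<Rightarrow> 'x" where "f ` {..<m} = A" "range f = A"
proof -
  obtain h where h: "bij_betw h {0..<card A} A"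
    using ex_bij_betw_nat_finite[OF assms(1)] by blast
  have c: "card A > 0" using assms by (simp add: card_gt_0_iff)
  define f where "f j = (if j < card A then h j else h 0)" for j
  have mem: "f j \<in> A" for j
    using bij_betwE[OF h] c by (simp add: f_def)
  have "A \<subseteq> f ` {..<m}"
  proof
    fix a assume "a \<in> A"
    then obtain j where "j < card A" "a = h j"
      using bij_betw_imp_surj_on[OF h] by fastforce
    then show "a \<in> f ` {..<m}"
      using assms(3) by (intro image_eqI[of _ _ j]) (simp_all add: f_def)
  qed
  then show thesis
    using that[of f] mem by blast
qed

section \<open>Bogolyubov's theorem for a countable abelian group\<close>

context comm_group
begin

definition lattice_hom :: "(nat \<Rightarrow> 'a) \<Rightarrow> nat \<Rightarrow> (nat \<Rightarrow> int) \<Rightarrow> 'a" where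
  "lattice_hom u n x = (\<Otimes>i\<in>{..<n}. u i [^] x i)"

lemma lattice_hom_closed: "range u \<subseteq> carrier G \<Longrightarrow> lattice_hom u n x \<in> carrier G"
  unfolding lattice_hom_def by (rule finprod_closed) auto

lemma lattice_hom_add:
  assumes "range u \<subseteq> carrier G"
  shows "lattice_hom u n (x + y) = lattice_hom u n x \<otimes> lattice_hom u n y"
proof -
  have u: "u i \<in> carrier G" for i using assms by auto
  have "lattice_hom u n (x + y) = (\<Otimes>i\<in>{..<n}. u i [^] x i \<otimes> u i [^] y i)"
    unfolding lattice_hom_def by (simp add: int_pow_mult u)
  also have "\<dots> = lattice_hom u n x \<otimes> lattice_hom u n y"
    unfolding lattice_hom_def by (rule finprod_multf) (auto simp: u)
  finally show ?thesis .
qed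

lemma lattice_hom_diff:
  assumes "range u \<subseteq> carrier G"
  shows "lattice_hom u n (x - y) = lattice_hom u n x \<otimes> inv lattice_hom u n y"
  using lattice_hom_add[OF assms, of n "x - y" y] lattice_hom_closed[OF assms]
  by (simp add: m_assoc)

lemma lattice_hom_unit_vector:
  assumes "range u \<subseteq> carrier G" "i < n"
  shows "lattice_hom u n (unit_vector i) = u i"
proof -
  have u: "u i \<in> carrier G" for i using assms by auto
  have "lattice_hom u n (unit_vector i) = (\<Otimes>j\<in>{..<n}. if i = j then u j else \<one>)"
    unfolding lattice_hom_def by (rule finprod_cong') (auto simp: unit_vector_def u)
  also have "\<dots> = u i"
    using finprod_singleton[of i "{..<n}" u] assms(2) u by auto
  finally show ?thesis .
qed

text \<open>In additive notation, the union of \<open>(A - A) - (A - A)\<close> over the colour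
  classes \<open>A\<close>. Unlike in \<open>Delta2\<close>, the four elements may coincide.\<close>

definition four_term_colour_set :: "('a \<Rightarrow> nat) \<Rightarrow> 'a set" where
  "four_term_colour_set c = {(w \<otimes> inv x) \<otimes> inv (y \<otimes> inv z) | w x y z.
     {w, x, y, z} \<subseteq> carrier G \<and> c x = c w \<and> c y = c w \<and> c z = c w}"

text \<open>Stage \<open>n\<close> of the compactness argument: \<open>t (j, a)\<close> is the value
  at \<open>u a\<close> of the \<open>j\<close>-th would-be character. Indexing by pairs of numbers
  places all stages in one countable product of circles.\<close>

definition approximate_characters ::
    "('a \<Rightarrow> nat) \<Rightarrow> (nat \<Rightarrow> 'a) \<Rightarrow> nat \<Rightarrow> nat \<Rightarrow> (nat \<times> nat \<Rightarrow> complex) \<Rightarrow> bool" where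
  "approximate_characters c u m n t \<longleftrightarrow> (\<forall>p. cmod (t p) = 1) \<and>
    (\<forall>j a b l. a < n \<and> b < n \<and> l < n \<and> u a \<otimes> u b = u l \<longrightarrow>
      cmod (t (j, a) * t (j, b) - t (j, l)) \<le> 1 / real (Suc n)) \<and>
    (\<forall>i. i < n \<and> (\<forall>j<m. cmod (t (j, i) - 1) \<le> 1/4) \<longrightarrow> u i \<in> four_term_colour_set c)"

text \<open>The colouring is pulled back to Z^n along \<open>lattice_hom\<close>. It is invariant
  under the relations between the first \<open>n\<close> elements, so the resulting characters are
  almost 1 on these relations, that is, almost multiplicative on the elements.\<close>

lemma approximate_characters_exist:
  fixes c :: "'a \<Rightarrow> nat" and u :: "nat \<Rightarrow> 'a"
  assumes k: "k > 0" "\<And>x. x \<in> carrier G \<Longrightarrow> c x < k" and u: "range u \<subseteq> carrier G"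
  shows "\<exists>t. approximate_characters c u (56 * k ^ 4 + 1) n t"
proof -
  let ?p = "lattice_hom u n"
  \<comment> \<open>The multiplication table of the first \<open>n\<close> elements, written as
    vectors that \<open>?p\<close> sends to the identity.\<close>
  define \<Lambda> where "\<Lambda> = (\<lambda>(a, b, l). unit_vector a + unit_vector b - unit_vector l) `
      {(a, b, l). (a, b, l) \<in> {..<n} \<times> {..<n} \<times> {..<n} \<and> u a \<otimes> u b = u l}"
  have um: "u i \<in> carrier G" for i using u by auto
  have fin: "finite \<Lambda>"
    unfolding \<Lambda>_def
    by (intro finite_imageI, rule finite_subset[of _ "{..<n} \<times> {..<n} \<times> {..<n}"]) auto
  have trivial: "?p l = \<one>" if "l \<in> \<Lambda>" for l
    using that by (auto simp: \<Lambda>_def lattice_hom_diff[OF u] lattice_hom_add[OF u]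
        lattice_hom_unit_vector[OF u] um)
  have inv_c: "c (?p (x + l)) = c (?p x)" if "l \<in> \<Lambda>" for x l
    by (simp add: lattice_hom_add[OF u] trivial[OF that] lattice_hom_closed[OF u])
  have bound: "\<bar>l i\<bar> \<le> 3" if "l \<in> \<Lambda>" for l i
    using that by (auto simp: \<Lambda>_def unit_vector_def)
  have supp: "l i = 0" if "l \<in> \<Lambda>" "i \<ge> n" for l i
    using that by (auto simp: \<Lambda>_def unit_vector_def)
  obtain \<Theta> :: "((nat \<Rightarrow> int) \<Rightarrow> complex) set"
    where \<Theta>: "finite \<Theta>" "card \<Theta> \<le> 56 * k ^ 4"
      "\<And>\<theta> g. \<theta> \<in> \<Theta> \<Longrightarrow> cmod (\<theta> g) = 1" "\<And>\<theta> g h. \<theta> \<in> \<Theta> \<Longrightarrow> \<theta> (g + h) = \<theta> g * \<theta> h"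
      "\<And>\<theta> l. \<theta> \<in> \<Theta> \<Longrightarrow> l \<in> \<Lambda> \<Longrightarrow> cmod (\<theta> l - 1) \<le> 1 / real (Suc n)"
      and \<Theta>_test: "\<And>i. i < n \<Longrightarrow> (\<And>\<theta>. \<theta> \<in> \<Theta> \<Longrightarrow> cmod (\<theta> (unit_vector i) - 1) \<le> 1/4) \<Longrightarrow>
        \<exists>w x y z. c (?p w) = c (?p x) \<and> c (?p w) = c (?p y) \<and> c (?p w) = c (?p z) \<and>
          (w - x) - (y - z) = unit_vector i"
    by (rule Bogolyubov_lattice[of k "\<lambda>x. c (?p x)" "1 / real (Suc n)" \<Lambda> n])
      (use k inv_c bound supp fin lattice_hom_closed[OF u] in simp_all)
  \<comment> \<open>the trivial character pads the family to a fixed nonzero length\<close>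
  define \<Theta>' where "\<Theta>' = insert (\<lambda>_. 1) \<Theta>"
  have \<Theta>'_unit: "cmod (\<theta> g) = 1" and \<Theta>'_add: "\<theta> (g + h) = \<theta> g * \<theta> h"
    and \<Theta>'_\<Lambda>: "l \<in> \<Lambda> \<Longrightarrow> cmod (\<theta> l - 1) \<le> 1 / real (Suc n)" if "\<theta> \<in> \<Theta>'" for \<theta> g h l
    using that \<Theta>(3-5) by (auto simp: \<Theta>'_def)
  obtain f where f: "f ` {..<56 * k ^ 4 + 1} = \<Theta>'" "range f = \<Theta>'"
  proof (rule finite_enumerated_below[of \<Theta>' "56 * k ^ 4 + 1"])
    show "finite \<Theta>'" "\<Theta>' \<noteq> {}" using \<Theta>(1) by (simp_all add: \<Theta>'_def)
    show "card \<Theta>' \<le> 56 * k ^ 4 + 1"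
      using \<Theta>(1,2) card_insert_le_m1[of "56 * k ^ 4 + 1" \<Theta> "\<lambda>_. 1"] by (simp add: \<Theta>'_def)
  qed
  have f_mem: "f j \<in> \<Theta>'" for j using f(2) by auto
  show ?thesis
    unfolding approximate_characters_def
  proof (intro exI[of _ "\<lambda>(j, i). f j (unit_vector i)"] conjI allI impI; (elim conjE)?)
    show "cmod (case p of (j, i) \<Rightarrow> f j (unit_vector i)) = 1" for p
      by (cases p) (simp add: \<Theta>'_unit[OF f_mem])
  next
    fix j a b l assume abl: "a < n" "b < n" "l < n" "u a \<otimes> u b = u l"
    let ?l = "unit_vector a + unit_vector b - unit_vector l"
    have "?l \<in> \<Lambda>"
      unfolding \<Lambda>_def using abl by (intro image_eqI[of _ _ "(a, b, l)"]) auto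
    then have "cmod (f j ?l - 1) \<le> 1 / real (Suc n)"
      by (rule \<Theta>'_\<Lambda>[OF f_mem])
    moreover have "f j (unit_vector a) * f j (unit_vector b) = f j ?l * f j (unit_vector l)"
      unfolding \<Theta>'_add[OF f_mem, symmetric] by simp
    then have "cmod (f j (unit_vector a) * f j (unit_vector b) - f j (unit_vector l)) =
        cmod ((f j ?l - 1) * f j (unit_vector l))"
      by (simp add: left_diff_distrib)
    ultimately show "cmod ((case (j, a) of (j, i) \<Rightarrow> f j (unit_vector i)) *
        (case (j, b) of (j, i) \<Rightarrow> f j (unit_vector i)) - (case (j, l) of (j, i) \<Rightarrow> f j (unit_vector i)))
        \<le> 1 / real (Suc n)"
      by (simp add: norm_mult \<Theta>'_unit[OF f_mem])
  next
    fix i assume i: "i < n" and small: "\<forall>j<56 * k ^ 4 + 1.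
        cmod ((case (j, i) of (j, i) \<Rightarrow> f j (unit_vector i)) - 1) \<le> 1/4"
    have "cmod (\<theta> (unit_vector i) - 1) \<le> 1/4" if "\<theta> \<in> \<Theta>" for \<theta>
    proof -
      have "\<theta> \<in> f ` {..<56 * k ^ 4 + 1}"
        unfolding f(1) using that by (simp add: \<Theta>'_def)
      then show ?thesis using small by auto
    qed
    then obtain w x y z where wxyz: "c (?p w) = c (?p x)" "c (?p w) = c (?p y)" "c (?p w) = c (?p z)"
      "(w - x) - (y - z) = unit_vector i"
      using \<Theta>_test[OF i] by blast
    have "u i = ?p ((w - x) - (y - z))"
      using lattice_hom_unit_vector[OF u i] wxyz(4) by simp
    also have "\<dots> = (?p w \<otimes> inv ?p x) \<otimes> inv (?p y \<otimes> inv ?p z)"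
      by (simp add: lattice_hom_diff[OF u])
    finally have ui: "u i = (?p w \<otimes> inv ?p x) \<otimes> inv (?p y \<otimes> inv ?p z)" .
    show "u i \<in> four_term_colour_set c"
      unfolding four_term_colour_set_def mem_Collect_eq
      by (rule exI[of _ "?p w"], rule exI[of _ "?p x"], rule exI[of _ "?p y"], rule exI[of _ "?p z"])
        (use ui wxyz lattice_hom_closed[OF u] in simp)
  qed
qed

text \<open>Take a limit of approximate characters along a subsequence. Any fixed elements are
  eventually among those listed, and the error tends to 0, so the limit is exactly multiplicative.
  The strict bound 1/4 is an open condition, hence already holds at some late stage, where the test
  for membership applies.\<close>

theorem Bogolyubov_colouring:
  fixes c :: "'a \<Rightarrow> nat"
  assumes "countable (carrier G)" and k: "k > 0" "\<And>x. x \<in> carrier G \<Longrightarrow> c x < k"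
  obtains m :: nat and \<psi> :: "nat \<Rightarrow> 'a \<Rightarrow> complex"
  where "m \<ge> 1" "\<And>j x. x \<in> carrier G \<Longrightarrow> cmod (\<psi> j x) = 1"
    "\<And>j x y. x \<in> carrier G \<Longrightarrow> y \<in> carrier G \<Longrightarrow> \<psi> j (x \<otimes> y) = \<psi> j x * \<psi> j y"
    "\<And>s. s \<in> carrier G \<Longrightarrow> \<forall>j<m. cmod (\<psi> j s - 1) < 1/4 \<Longrightarrow> s \<in> four_term_colour_set c"
proof -
  define u where "u = from_nat_into (carrier G)"
  define N where "N = to_nat_on (carrier G)"
  have u: "range u \<subseteq> carrier G"
    unfolding u_def by (auto intro: from_nat_into)
  have uN: "u (N x) = x" if "x \<in> carrier G" for x
    using from_nat_into_to_nat_on[OF assms(1) that] by (simp add: u_def N_def)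
  define m where "m = 56 * k ^ 4 + 1"
  have "\<forall>n. \<exists>t. approximate_characters c u m n t"
    unfolding m_def using approximate_characters_exist[OF k(1) _ u] k(2) by blast
  then obtain t where t: "\<And>n. approximate_characters c u m n (t n)"
    by metis
  have t_unit: "cmod (t n p) = 1" for n p
    using t[of n] unfolding approximate_characters_def by blast
  have t_mult: "cmod (t n (j, a) * t n (j, b) - t n (j, l)) \<le> 1 / real (Suc n)"
    if "a < n" "b < n" "l < n" "u a \<otimes> u b = u l" for n j a b l
    using t[of n] that unfolding approximate_characters_def by blast
  have t_test: "u i \<in> four_term_colour_set c"
    if "i < n" "\<And>j. j < m \<Longrightarrow> cmod (t n (j, i) - 1) \<le> 1/4" for n i
    using t[of n] that unfolding approximate_characters_def by blast
  from compact_circle_family[of t, OF t_unit] obtain \<tau> r where r: "strict_mono (r :: nat \<Rightarrow> nat)"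
    and \<tau>: "\<forall>p. cmod (\<tau> p) = 1 \<and> (\<lambda>n. t (r n) p) \<longlonglongrightarrow> \<tau> p"
    by (elim exE conjE)
  have \<tau>_unit: "cmod (\<tau> p) = 1" and lim: "(\<lambda>n. t (r n) p) \<longlonglongrightarrow> \<tau> p" for p
    using spec[OF \<tau>, of p] by auto
  have r_ge: "eventually (\<lambda>n. i < r n) sequentially" for i
    by (rule eventually_mono[OF eventually_gt_at_top[of i]]) (use seq_suble[OF r] less_le_trans in blast)
  show thesis
  proof (rule that[of m "\<lambda>j x. \<tau> (j, N x)"])
    show "m \<ge> 1" by (simp add: m_def)
    show "cmod (\<tau> (j, N x)) = 1" for j x by (rule \<tau>_unit)
    fix j x y assume xy: "x \<in> carrier G" "y \<in> carrier G"
    let ?d = "\<lambda>n. t (r n) (j, N x) * t (r n) (j, N y) - t (r n) (j, N (x \<otimes> y))"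
    have "?d \<longlonglongrightarrow> \<tau> (j, N x) * \<tau> (j, N y) - \<tau> (j, N (x \<otimes> y))"
      by (intro tendsto_intros lim)
    moreover have "?d \<longlonglongrightarrow> 0"
    proof (rule Lim_null_comparison)
      show "eventually (\<lambda>n. cmod (?d n) \<le> 1 / real (Suc (r n))) sequentially"
        using r_ge[of "N x"] r_ge[of "N y"] r_ge[of "N (x \<otimes> y)"]
        by eventually_elim (rule t_mult, simp_all add: uN xy)
      show "(\<lambda>n. 1 / real (Suc (r n))) \<longlonglongrightarrow> 0"
        using LIMSEQ_subseq_LIMSEQ[OF LIMSEQ_inverse_real_of_nat r]
        by (simp add: o_def inverse_eq_divide)
    qed
    ultimately have "\<tau> (j, N x) * \<tau> (j, N y) - \<tau> (j, N (x \<otimes> y)) = 0"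
      by (rule LIMSEQ_unique)
    then show "\<tau> (j, N (x \<otimes> y)) = \<tau> (j, N x) * \<tau> (j, N y)"
      by simp
  next
    fix s assume s: "s \<in> carrier G" and small: "\<forall>j<m. cmod (\<tau> (j, N s) - 1) < 1/4"
    have "eventually (\<lambda>n. cmod (t (r n) (j, N s) - 1) < 1/4) sequentially" if "j < m" for j
      using small[rule_format, OF that] by (intro order_tendstoD(2)[of _ "cmod (\<tau> (j, N s) - 1)"] tendsto_intros lim)
    then have "eventually (\<lambda>n. \<forall>j\<in>{..<m}. cmod (t (r n) (j, N s) - 1) < 1/4) sequentially"
      by (intro eventually_ball_finite) auto
    then have "eventually (\<lambda>n. N s < r n \<and> (\<forall>j\<in>{..<m}. cmod (t (r n) (j, N s) - 1) < 1/4)) sequentially"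
      using r_ge by (rule eventually_conj[rotated])
    then obtain n where "N s < r n" "\<forall>j\<in>{..<m}. cmod (t (r n) (j, N s) - 1) < 1/4"
      by (metis (no_types, lifting) eventually_sequentially order_refl)
    then have "u (N s) \<in> four_term_colour_set c"
      by (intro t_test) (auto intro: less_imp_le)
    then show "s \<in> four_term_colour_set c"
      by (simp add: uN s)
  qed
qed

end

section \<open>Bohr recurrence and the circle group\<close>

definition circle_coset :: "real \<Rightarrow> real set" where
  "circle_coset x = {x - of_int n | n::int. True}"

lemma circle_coset_eqI:
  assumes "x - y = of_int m"
  shows "circle_coset x = circle_coset y"
proof -
  have "x - of_int n = y - of_int (n - m)" "y - of_int n = x - of_int (n + m)" for n
    using assms by simp_all
  then show ?thesis
    unfolding circle_coset_def by blast
qed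

lemma circle_coset_in_carrier: "circle_coset x \<in> carrier circle_group"
  unfolding carrier_circle_group circle_coset_def by blast

lemma circle_carrierE:
  assumes "X \<in> carrier circle_group"
  obtains x where "X = circle_coset x" "0 \<le> x" "x < 1"
proof -
  obtain y where "X = circle_coset y"
    using assms unfolding carrier_circle_group circle_coset_def by blast
  also have "circle_coset y = circle_coset (frac y)"
    by (rule circle_coset_eqI[of _ _ "\<lfloor>y\<rfloor>"]) (simp add: frac_def)
  finally show thesis
    using that[of "frac y"] by (simp add: frac_lt_1)
qed

lemma circle_coset_mult: "circle_coset x \<otimes>\<^bsub>circle_group\<^esub> circle_coset y = circle_coset (x + y)"
proof -
  have "circle_coset x \<otimes>\<^bsub>circle_group\<^esub> circle_coset y = {a + b | a b. a \<in> circle_coset x \<and> b \<in> circle_coset y}"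
    by (auto simp: circle_group_def FactGroup_def set_mult_def real_group_def)
  also have "\<dots> = circle_coset (x + y)"
  proof (intro equalityI subsetI)
    fix z assume "z \<in> {a + b | a b. a \<in> circle_coset x \<and> b \<in> circle_coset y}"
    then obtain m n :: int where "z = (x - of_int m) + (y - of_int n)"
      unfolding circle_coset_def by blast
    then have "z = x + y - of_int (m + n)" by simp
    then show "z \<in> circle_coset (x + y)"
      unfolding circle_coset_def by blast
  next
    fix z assume "z \<in> circle_coset (x + y)"
    then obtain n :: int where "z = x + y - of_int n"
      unfolding circle_coset_def by blast
    then have "z = (x - of_int 0) + (y - of_int n)" by simp
    then show "z \<in> {a + b | a b. a \<in> circle_coset x \<and> b \<in> circle_coset y}"
      unfolding circle_coset_def by blast
  qed
  finally show ?thesis .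
qed

lemma circle_coset_inv: "inv\<^bsub>circle_group\<^esub> circle_coset x = circle_coset (- x)"
proof -
  interpret comm_group circle_group by (rule comm_group_circle_group)
  have one: "circle_coset 0 = \<one>\<^bsub>circle_group\<^esub>"
    using circle_coset_mult[of 0 0] r_cancel_one[OF circle_coset_in_carrier circle_coset_in_carrier]
    by simp
  show ?thesis
    by (rule inv_equality) (simp_all add: circle_coset_mult circle_coset_in_carrier one)
qed

lemma circle_norm_circle_coset_le: "circle_norm (circle_coset x) \<le> \<bar>x\<bar>"
  using circle_norm_coset(2)[of x 0] by (simp add: circle_coset_def)

text \<open>A chord, of length twice the sine of half the angle, is no longer than its arc.\<close>

lemma cmod_cis_diff_1_le: "cmod (cis x - 1) \<le> \<bar>x\<bar>"
proof -
  have "(cmod (cis x - 1))\<^sup>2 = 2 - 2 * cos x"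
    by (simp add: cmod_power2 power2_diff)
  also have "\<dots> = (2 * sin (x / 2))\<^sup>2"
    using cos_double_sin[of "x / 2"] by (simp add: power_mult_distrib)
  also have "\<dots> \<le> \<bar>x\<bar>\<^sup>2"
    using abs_sin_x_le_abs_x[of "x / 2"] unfolding abs_le_square_iff[symmetric] by simp
  finally show ?thesis
    by (rule power2_le_imp_le) simp
qed

lemma cis_close_to_1:
  assumes "circle_norm (circle_coset x) < 1/32"
  shows "cmod (cis (2 * pi * x) - 1) < 1/4"
proof -
  have "\<bar>x - of_int (round x)\<bar> < 1/32"
    using assms circle_norm_coset(1)[of x] by (simp add: circle_coset_def)
  then have "\<bar>2 * pi * (x - of_int (round x))\<bar> < 2 * pi * (1/32)"
    by (simp add: abs_mult)
  \<comment> \<open>The threshold 1/32 is chosen for this: \<open>pi < 4\<close> gives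
    \<open>2 * pi / 32 < 1/4\<close>.\<close>
  also have "\<dots> < 1/4"
    using pi_less_4 by simp
  finally have "cmod (cis (2 * pi * (x - of_int (round x))) - 1) < 1/4"
    using cmod_cis_diff_1_le[of "2 * pi * (x - of_int (round x))"] by linarith
  moreover have "cis (2 * pi * (x - of_int (round x))) = cis (2 * pi * x)"
    by (simp add: right_diff_distrib flip: cis_divide)
  ultimately show ?thesis by simp
qed

lemma torus_norm_less_iff:
  assumes "d \<ge> 1"
  shows "torus_norm d x < \<epsilon> \<longleftrightarrow> (\<forall>j\<in>{1..d}. circle_norm (x j) < \<epsilon>)"
  using assms unfolding torus_norm_def by (subst Max_less_iff) auto

text \<open>Arguments turn the \<open>m\<close> complex characters into one homomorphism to a torus.
  \<open>Arg\<close> is additive only up to multiples of \<open>2 * pi\<close>, which the cosets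
  absorb.\<close>

lemma (in comm_group) Bohr_recurrence_characters:
  fixes \<psi> :: "nat \<Rightarrow> 'a \<Rightarrow> complex"
  assumes S: "Bohr_recurrence G S" "S \<subseteq> carrier G" and "m \<ge> 1"
    and unit: "\<And>j x. x \<in> carrier G \<Longrightarrow> cmod (\<psi> j x) = 1"
    and mult: "\<And>j x y. x \<in> carrier G \<Longrightarrow> y \<in> carrier G \<Longrightarrow> \<psi> j (x \<otimes> y) = \<psi> j x * \<psi> j y"
  shows "\<exists>s\<in>S. \<forall>j<m. cmod (\<psi> j s - 1) < 1/4"
proof -
  define t where "t j x = Arg (\<psi> j x) / (2 * pi)" for j x
  have cis_t: "cis (2 * pi * t j x) = \<psi> j x" if "x \<in> carrier G" for j x
    using rcis_cmod_Arg[of "\<psi> j x"] unit[OF that] by (simp add: t_def rcis_def)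
  \<comment> \<open>Torus coordinates are numbered from 1, the characters from 0.\<close>
  define \<rho> where "\<rho> x = (\<lambda>j\<in>{1..m}. circle_coset (t (j - 1) x))" for x
  have t_mult: "circle_coset (t j (x \<otimes> y)) = circle_coset (t j x + t j y)"
    if xy: "x \<in> carrier G" "y \<in> carrier G" for j x y
  proof -
    have "cis (2 * pi * t j (x \<otimes> y)) = cis (2 * pi * (t j x + t j y))"
      using xy by (simp add: cis_t mult distrib_left flip: cis_mult)
    then have "cis (2 * pi * (t j (x \<otimes> y) - (t j x + t j y))) = 1"
      by (simp add: right_diff_distrib flip: cis_divide)
    then have "cos (2 * pi * (t j (x \<otimes> y) - (t j x + t j y))) = 1"
      by (metis cis.sel(1) one_complex.sel(1))
    then obtain n :: int where "2 * pi * (t j (x \<otimes> y) - (t j x + t j y)) = of_int n * 2 * pi"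
      using cos_one_2pi_int by blast
    then have "t j (x \<otimes> y) - (t j x + t j y) = of_int n"
      by simp
    then show ?thesis by (rule circle_coset_eqI)
  qed
  have "\<rho> \<in> hom G (torus_group m)"
    by (rule homI) (auto simp: \<rho>_def torus_group_def circle_coset_in_carrier t_mult circle_coset_mult fun_eq_iff)
  then obtain s where s: "s \<in> S" "torus_norm m (\<rho> s) < 1/32"
    using S(1) \<open>m \<ge> 1\<close> unfolding Bohr_recurrence_def by (meson divide_pos_pos zero_less_numeral zero_less_one)
  have "cmod (\<psi> j s - 1) < 1/4" if "j < m" for j
  proof -
    have "circle_norm (\<rho> s (Suc j)) < 1/32"
      using s(2) that unfolding torus_norm_less_iff[OF \<open>m \<ge> 1\<close>] by simp
    then have "cmod (cis (2 * pi * t j s) - 1) < 1/4"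
      using that by (intro cis_close_to_1) (simp add: \<rho>_def)
    then show ?thesis
      using cis_t[of s j] s(1) S(2) by auto
  qed
  then show ?thesis using s(1) by blast
qed

text \<open>The colours are cubic cells of side \<open>1 / M\<close> in the unit cube of
  representatives. Within one cell each of the two differences is below \<open>1 / M\<close> in
  every coordinate, so the combination stays below \<open>2 / M < \<epsilon>\<close>.\<close>

lemma torus_colouring:
  fixes \<rho> :: "(nat \<Rightarrow>\<^sub>0 int) \<Rightarrow> nat \<Rightarrow> real set"
  assumes \<rho>: "\<rho> \<in> hom Z_omega (torus_group d)" and d: "d \<ge> 1" and "\<epsilon> > 0"
  obtains k :: nat and \<kappa> :: "nat \<Rightarrow> nat" where "k > 0" "\<And>j. \<kappa> j < k"
    "\<And>a b c e. \<kappa> b = \<kappa> a \<Longrightarrow> \<kappa> c = \<kappa> a \<Longrightarrow> \<kappa> e = \<kappa> a \<Longrightarrow>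
      torus_norm d (\<rho> ((frag_of a - frag_of b) - (frag_of c - frag_of e))) < \<epsilon>"
proof -
  interpret T: comm_group circle_group by (rule comm_group_circle_group)
  have torus: "group (torus_group d)"
    unfolding torus_group_def by (rule product_group) (rule T.is_group)
  interpret group_hom Z_omega "torus_group d" \<rho>
    using \<rho> torus by (simp add: group_hom_def group_hom_axioms_def Z_omega_def)
  have carrier: "x \<in> carrier Z_omega" for x
    by (simp add: Z_omega_def)
  have mem: "\<rho> x i \<in> carrier circle_group" if "i \<in> {1..d}" for x i
    using hom_closed[OF carrier, of x] that by (auto simp: torus_group_def PiE_iff)
  have mult: "\<rho> (x + y) i = \<rho> x i \<otimes>\<^bsub>circle_group\<^esub> \<rho> y i" if "i \<in> {1..d}" for x y i
    using hom_mult[OF carrier carrier, of x y] that by (simp add: torus_group_def Z_omega_def)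
  have "\<forall>j. \<forall>i\<in>{1..d}. \<exists>x. \<rho> (frag_of j) i = circle_coset x \<and> 0 \<le> x \<and> x < 1"
    using mem circle_carrierE by metis
  then obtain x where x: "\<And>i j. i \<in> {1..d} \<Longrightarrow> \<rho> (frag_of j) i = circle_coset (x j i)"
      "\<And>i j. i \<in> {1..d} \<Longrightarrow> 0 \<le> x j i" "\<And>i j. i \<in> {1..d} \<Longrightarrow> x j i < 1"
    by metis
  obtain M :: nat where M: "2 / \<epsilon> < real M"
    using reals_Archimedean2 by blast
  have "M > 0" using M \<open>\<epsilon> > 0\<close> by (cases M) (auto simp: field_simps)
  define cell where "cell j = (\<lambda>i\<in>{1..d}. \<lfloor>real M * x j i\<rfloor>)" for j
  let ?P = "{1..d} \<rightarrow>\<^sub>E {0..<int M}"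
  have cell: "cell j \<in> ?P" for j
  proof (rule PiE_I)
    fix i assume i: "i \<in> {1..d}"
    have "0 \<le> real M * x j i" "real M * x j i < real M"
      using x(2,3)[OF i, of j] \<open>M > 0\<close> by simp_all
    then show "cell j i \<in> {0..<int M}"
      using i by (simp add: cell_def floor_less_iff)
  qed (auto simp: cell_def)
  have "finite ?P" by (intro finite_PiE) auto
  then obtain e :: "(nat \<Rightarrow> int) \<Rightarrow> nat" and k where e: "e ` ?P = {i. i < k}" "inj_on e ?P"
    using finite_imp_inj_to_nat_seg by metis
  show thesis
  proof (rule that[of k "\<lambda>j. e (cell j)"])
    show lt: "e (cell j) < k" for j
      using e(1) cell[of j] by blast
    then show "k > 0" by (metis not_less_zero neq0_conv)
    fix a b c f assume "e (cell b) = e (cell a)" "e (cell c) = e (cell a)" "e (cell f) = e (cell a)"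
    then have eq: "cell b = cell a" "cell c = cell a" "cell f = cell a"
      using inj_onD[OF e(2) _ cell cell] by blast+
    let ?y = "(frag_of a - frag_of b) - (frag_of c - frag_of f)"
    show "torus_norm d (\<rho> ?y) < \<epsilon>"
      unfolding torus_norm_less_iff[OF d]
    proof
      fix i assume i: "i \<in> {1..d}"
      have minus: "\<rho> (g - h) i = circle_coset (r - s)"
        if "\<rho> g i = circle_coset r" "\<rho> h i = circle_coset s" for g h r s
      proof -
        have "\<rho> (g - h) i \<otimes>\<^bsub>circle_group\<^esub> circle_coset s = circle_coset r"
          using mult[OF i, of "g - h" h] that by simp
        then have "\<rho> (g - h) i = circle_coset r \<otimes>\<^bsub>circle_group\<^esub> inv\<^bsub>circle_group\<^esub> circle_coset s"
          by (intro T.inv_solve_right[THEN iffD2]) (simp_all add: circle_coset_in_carrier mem[OF i])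
        then show ?thesis
          by (simp add: circle_coset_inv circle_coset_mult)
      qed
      have "\<rho> ?y i = circle_coset ((x a i - x b i) - (x c i - x f i))"
        by (intro minus x(1) i)
      then have "circle_norm (\<rho> ?y i) \<le> \<bar>(x a i - x b i) - (x c i - x f i)\<bar>"
        by (simp add: circle_norm_circle_coset_le)
      also have "\<dots> < \<epsilon>"
      proof -
        define v where "v = \<lfloor>real M * x a i\<rfloor>"
        have floors: "\<lfloor>real M * x b i\<rfloor> = v" "\<lfloor>real M * x c i\<rfloor> = v" "\<lfloor>real M * x f i\<rfloor> = v"
          using fun_cong[OF eq(1), of i] fun_cong[OF eq(2), of i] fun_cong[OF eq(3), of i] i
          by (simp_all add: cell_def v_def)
        have fl: "of_int v \<le> real M * x p i \<and> real M * x p i < of_int v + 1"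
          if "\<lfloor>real M * x p i\<rfloor> = v" for p
          using that by (simp add: floor_eq_iff)
        have "\<bar>real M * x a i - real M * x b i - (real M * x c i - real M * x f i)\<bar> < 2"
          using fl[of a] fl[OF floors(1)] fl[OF floors(2)] fl[OF floors(3)] unfolding v_def by linarith
        moreover have "real M * x a i - real M * x b i - (real M * x c i - real M * x f i) =
            real M * ((x a i - x b i) - (x c i - x f i))"
          by (simp add: right_diff_distrib)
        ultimately have "real M * \<bar>(x a i - x b i) - (x c i - x f i)\<bar> < 2"
          by (simp add: abs_mult)
        also have "2 < real M * \<epsilon>"
          using M \<open>\<epsilon> > 0\<close> by (simp add: field_simps)
        finally show ?thesis
          using \<open>M > 0\<close> by simp
      qed
      finally show "circle_norm (\<rho> ?y i) < \<epsilon>" .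
    qed
  qed
qed

section \<open>Transfer of recurrence between \<open>Z_omega\<close> and \<open>G\<close>\<close>

lemma (in group) chromatic_recurrence_image:
  assumes "group_hom G H h" and "chromatic_recurrence G S'" and "h ` S' \<subseteq> S"
  shows "chromatic_recurrence H S"
  unfolding chromatic_recurrence_def
proof (intro allI impI ballI)
  interpret group_hom G H h by fact
  fix r f assume r: "r \<ge> 1" and f: "f \<in> carrier H \<rightarrow> {1..r::nat}"
  \<comment> \<open>Recurrence moves forward along \<open>h\<close> because colourings pull back
    along it.\<close>
  have "f \<circ> h \<in> carrier G \<rightarrow> {1..r}"
    using f by auto
  then obtain a b where ab: "a \<in> carrier G" "b \<in> carrier G" "(f \<circ> h) a = (f \<circ> h) b" "b \<otimes>\<^bsub>G\<^esub> inv\<^bsub>G\<^esub> a \<in> S'"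
    using assms(2) r unfolding chromatic_recurrence_def by blast
  have "h (b \<otimes>\<^bsub>G\<^esub> inv\<^bsub>G\<^esub> a) \<in> S"
    using ab(4) assms(3) by blast
  then show "\<exists>a\<in>carrier H. \<exists>b\<in>carrier H. f a = f b \<and> b \<otimes>\<^bsub>H\<^esub> inv\<^bsub>H\<^esub> a \<in> S"
    using ab(1-3) by (intro bexI[of _ "h a"] bexI[of _ "h b"]) simp_all
qed

lemma four_distinct_elements:
  assumes "infinite A" "infinite B" "infinite C" "infinite D"
  obtains a b c d where "a \<in> A" "b \<in> B" "c \<in> C" "d \<in> D" "distinct [a, b, c, d]"
proof -
  have ex: "\<exists>x\<in>X. x \<notin> F" if "infinite X" "finite F" for X F :: "'a set"
    using finite_subset[of X F] that by auto
  obtain a where a: "a \<in> A" using ex[OF assms(1), of "{}"] by auto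
  obtain b where b: "b \<in> B" "b \<notin> {a}" using ex[OF assms(2), of "{a}"] by auto
  obtain c where c: "c \<in> C" "c \<notin> {a, b}" using ex[OF assms(3), of "{a, b}"] by auto
  obtain d where d: "d \<in> D" "d \<notin> {a, b, c}" using ex[OF assms(4), of "{a, b, c}"] by auto
  show thesis
    by (rule that[OF a b(1) c(1) d(1)]) (use b c d in auto)
qed

text \<open>Each index is read as a coded pair; the ignored second component supplies the infinitely
  many repetitions.\<close>

lemma enumeration_with_infinite_multiplicity:
  assumes "countable A" "A \<noteq> {}"
  obtains g :: "nat \<Rightarrow> 'a" where "range g \<subseteq> A" "\<And>a. a \<in> A \<Longrightarrow> infinite {j. g j = a}"
proof (rule that)
  let ?g = "\<lambda>j. from_nat_into A (fst (prod_decode j))"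
  show "range ?g \<subseteq> A"
    using from_nat_into[OF assms(2)] by auto
  fix a assume a: "a \<in> A"
  have "range (\<lambda>n. prod_encode (to_nat_on A a, n)) \<subseteq> {j. ?g j = a}"
    using from_nat_into_to_nat_on[OF assms(1) a] by auto
  moreover have "infinite (range (\<lambda>n. prod_encode (to_nat_on A a, n)))"
    by (rule range_inj_infinite) (auto simp: inj_def)
  ultimately show "infinite {j. ?g j = a}"
    by (rule infinite_super)
qed

text \<open>A homomorphism from \<open>Z_omega\<close> to a torus need not factor through
  \<open>h\<close>, so it is replaced by a colouring of \<open>G\<close>, to which Bogolyubov's
  theorem applies.\<close>

lemma Bohr_recurrence_pullback:
  fixes G :: "('a, 'b) monoid_scheme"
  assumes G: "comm_group G" "countable (carrier G)"
    and h: "group_hom Z_omega G h" and inf: "\<And>x. x \<in> carrier G \<Longrightarrow> infinite {j. h (frag_of j) = x}"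
    and S: "S \<subseteq> carrier G" "Bohr_recurrence G S"
  shows "Bohr_recurrence Z_omega {x \<in> Delta2 Z_omega E1. h x \<in> S}"
  unfolding Bohr_recurrence_def
proof (intro allI impI ballI)
  interpret G: comm_group G by fact
  interpret group_hom Z_omega G h by fact
  fix d :: nat and \<rho> and \<epsilon> :: real
  assume d: "d \<ge> 1" and \<rho>: "\<rho> \<in> hom Z_omega (torus_group d)" and "\<epsilon> > 0"
  obtain \<kappa> :: "nat \<Rightarrow> nat" and k :: nat where k: "k > 0" "\<And>j. \<kappa> j < k"
    and cells: "\<And>a b c e. \<kappa> b = \<kappa> a \<Longrightarrow> \<kappa> c = \<kappa> a \<Longrightarrow> \<kappa> e = \<kappa> a \<Longrightarrow>
      torus_norm d (\<rho> ((frag_of a - frag_of b) - (frag_of c - frag_of e))) < \<epsilon>"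
    by (rule torus_colouring[OF \<rho> d \<open>\<epsilon> > 0\<close>]) (rule that)
  \<comment> \<open>Pigeonhole: infinitely many generators lie above \<open>x\<close> and only
    \<open>k\<close> cells are available. The cell chosen here becomes the colour of
    \<open>x\<close>.\<close>
  have "\<exists>v. v < k \<and> infinite {j. h (frag_of j) = x \<and> \<kappa> j = v}" if "x \<in> carrier G" for x
  proof -
    have "\<exists>v\<in>{..<k}. infinite {j \<in> {j. h (frag_of j) = x}. \<kappa> j = v}"
      by (rule pigeonhole_infinite_rel) (use inf[OF that] k in auto)
    then show ?thesis by auto
  qed
  then obtain c where c: "\<And>x. x \<in> carrier G \<Longrightarrow> c x < k"
      "\<And>x. x \<in> carrier G \<Longrightarrow> infinite {j. h (frag_of j) = x \<and> \<kappa> j = c x}"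
    by metis
  obtain \<psi> :: "nat \<Rightarrow> 'a \<Rightarrow> complex" and m :: nat
    where \<psi>: "m \<ge> 1" "\<And>j x. x \<in> carrier G \<Longrightarrow> cmod (\<psi> j x) = 1"
      "\<And>j x y. x \<in> carrier G \<Longrightarrow> y \<in> carrier G \<Longrightarrow> \<psi> j (x \<otimes>\<^bsub>G\<^esub> y) = \<psi> j x * \<psi> j y"
      and test: "\<And>s. s \<in> carrier G \<Longrightarrow> \<forall>j<m. cmod (\<psi> j s - 1) < 1/4 \<Longrightarrow>
        s \<in> G.four_term_colour_set c"
    by (rule G.Bogolyubov_colouring[OF G(2) k(1) c(1)]) (assumption, rule that)
  have "\<exists>s\<in>S. \<forall>j<m. cmod (\<psi> j s - 1) < 1/4"
    by (rule G.Bohr_recurrence_characters[OF S(2,1) \<psi>(1)]) (use \<psi>(2,3) in simp_all)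
  then obtain s where s: "s \<in> S" "\<forall>j<m. cmod (\<psi> j s - 1) < 1/4"
    by blast
  have "s \<in> G.four_term_colour_set c"
    using s S(1) by (intro test) auto
  then obtain w x y z where wxyz: "w \<in> carrier G" "x \<in> carrier G" "y \<in> carrier G" "z \<in> carrier G"
    and same: "c x = c w" "c y = c w" "c z = c w"
    and s_eq: "s = (w \<otimes>\<^bsub>G\<^esub> inv\<^bsub>G\<^esub> x) \<otimes>\<^bsub>G\<^esub> inv\<^bsub>G\<^esub> (y \<otimes>\<^bsub>G\<^esub> inv\<^bsub>G\<^esub> z)"
    unfolding G.four_term_colour_set_def by blast
  \<comment> \<open>Infinite fibres permit distinct indices, as \<open>Delta2\<close> demands, even
    where some of \<open>w\<close>, \<open>x\<close>, \<open>y\<close>, \<open>z\<close>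
    coincide.\<close>
  obtain j1 j2 j3 j4 where j: "h (frag_of j1) = w \<and> \<kappa> j1 = c w" "h (frag_of j2) = x \<and> \<kappa> j2 = c x"
    "h (frag_of j3) = y \<and> \<kappa> j3 = c y" "h (frag_of j4) = z \<and> \<kappa> j4 = c z" "distinct [j1, j2, j3, j4]"
    by (rule four_distinct_elements[OF c(2)[OF wxyz(1)] c(2)[OF wxyz(2)] c(2)[OF wxyz(3)] c(2)[OF wxyz(4)]])
      blast
  have carrier: "g \<in> carrier Z_omega" for g
    by (simp add: Z_omega_def)
  have minus: "g \<otimes>\<^bsub>Z_omega\<^esub> inv\<^bsub>Z_omega\<^esub> g' = g - g'" for g g'
    by (simp add: Z_omega_def)
  let ?y = "(frag_of j1 - frag_of j2) - (frag_of j3 - frag_of j4)"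
  have "h (g - g') = h g \<otimes>\<^bsub>G\<^esub> inv\<^bsub>G\<^esub> h g'" for g g'
    using hom_mult[OF carrier carrier, of g "inv\<^bsub>Z_omega\<^esub> g'"] hom_inv[OF carrier, of g'] minus by simp
  then have "h ?y = s"
    using j s_eq by simp
  moreover have "?y \<in> Delta2 Z_omega E1"
  proof -
    have "frag_of i = frag_of j \<longleftrightarrow> i = j" for i j :: nat
      by (metis lookup_single_eq lookup_single_not_eq zero_neq_one)
    then have "distinct [frag_of j1, frag_of j2, frag_of j3, frag_of j4]"
      using j(5) by simp
    moreover have "frag_of i \<in> E1" for i
      unfolding E1_def by blast
    ultimately show ?thesis
      unfolding Delta2_def mem_Collect_eq minus
      by (intro exI[of _ "frag_of j1"] exI[of _ "frag_of j2"] exI[of _ "frag_of j3"] exI[of _ "frag_of j4"] conjI refl)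
  qed
  moreover have "torus_norm d (\<rho> ?y) < \<epsilon>"
    using j same by (intro cells) simp_all
  ultimately show "\<exists>s\<in>{x \<in> Delta2 Z_omega E1. h x \<in> S}. torus_norm d (\<rho> s) < \<epsilon>"
    using s(1) by (intro bexI[of _ ?y]) simp_all
qed

theorem proposition3p3:
  fixes G :: "('a, 'b) monoid_scheme"
  assumes "\<forall>S. S \<subseteq> Delta2 Z_omega E1 \<and> Bohr_recurrence Z_omega S
             \<longrightarrow> chromatic_recurrence Z_omega S"
    and "comm_group G" and "countable (carrier G)" and "infinite (carrier G)"
  shows "\<forall>S. S \<subseteq> carrier G \<and> Bohr_recurrence G S \<longrightarrow> chromatic_recurrence G S"
proof (intro allI impI)
  fix S assume S: "S \<subseteq> carrier G \<and> Bohr_recurrence G S"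
  interpret G: comm_group G by fact
  obtain g :: "nat \<Rightarrow> 'a" where g: "range g \<subseteq> carrier G" "\<And>x. x \<in> carrier G \<Longrightarrow> infinite {j. g j = x}"
    using enumeration_with_infinite_multiplicity[OF assms(3)] G.carrier_not_empty by blast
  \<comment> \<open>Freeness of \<open>Z_omega\<close> allows the values at the generators to be
    prescribed, here with every element of \<open>G\<close> taken infinitely often.\<close>
  obtain h where h: "h \<in> hom Z_omega G" "\<And>j. h (frag_of j) = g j"
    using G.free_Abelian_group_universal[of g UNIV] g(1) unfolding Z_omega_def by auto
  have Z: "group Z_omega" by (simp add: Z_omega_def)
  have gh: "group_hom Z_omega G h"
    using h(1) Z by (simp add: group_hom_def group_hom_axioms_def)
  let ?S' = "{x \<in> Delta2 Z_omega E1. h x \<in> S}"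
  have "infinite {j. h (frag_of j) = x}" if "x \<in> carrier G" for x
    using g(2)[OF that] by (simp add: h(2))
  then have "Bohr_recurrence Z_omega ?S'"
    using S by (intro Bohr_recurrence_pullback[OF assms(2,3) gh]) simp_all
  then have "chromatic_recurrence Z_omega ?S'"
    by (intro assms(1)[rule_format]) simp
  then show "chromatic_recurrence G S"
    by (rule group.chromatic_recurrence_image[OF Z gh]) blast
qed

end
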